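(* Let $(\Omega,\mathcal E,\mathbb P)$ be a probability space and $\mathcal F\subset\mathcal E$ a sub-$\sigma$-algebra. Suppose that $(p,q)$ are Hölder conjugates with $1\le p<\infty$. If $\rho:L^p_{\mathcal F}(\mathcal E)\to L^0(\mathcal F)$ is a conditional risk measure, then $\rho$ has the Lebesgue property, and for every $x\in L^p_{\mathcal F}(\mathcal E)$ there exists $y\in L^q_{\mathcal F}(\mathcal E)$ with $y\le0$ and $\mathbb E_{\mathbb P}[y|\mathcal F]=-1$ such that $$\rho(x)=\mathbb E_{\mathbb P}[xy|\mathcal F]-\rho^\#(y).$$
   Context: $L^0(\mathcal E)$ is the space of real-valued $\mathcal E$-measurable random variables modulo a.s. equality, ordered by a.s. inequality; $L^0(\mathcal F)$ is defined likewise; $\overline{L^0}(\mathcal F)$ denotes the classes of $\mathcal F$-measurable $[-\infty,\infty]$-valued random variables. Suprema of families in $\overline{L^0}(\mathcal F)$ are essential suprema. The extended conditional expectation is $\mathbb E_{\mathbb P}[x|\mathcal F]:=\lim_n\mathbb E_{\mathbb P}[x^+\wedge n|\mathcal F]-\lim_n\mathbb E_{\mathbb P}[x^-\wedge n|\mathcal F]\in\overline{L^0}(\mathcal F)$ whenever at least one of the limits is finite. For $1\le r<\infty$, $L^r_{\mathcal F}(\mathcal E):=\{x\in L^0(\mathcal E):\mathbb E_{\mathbb P}[|x|^r|\mathcal F]<\infty\}$; $L^\infty_{\mathcal F}(\mathcal E):=\{x\in L^0(\mathcal E):|x|\le\eta\text{ for some }\eta\in L^0(\mathcal F)\}$. Write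 $\mathscr X:=L^p_{\mathcal F}(\mathcal E)$. A *conditional risk measure* is $\rho:\mathscr X\to L^0(\mathcal F)$ with: $\rho(\eta x+(1-\eta)y)\le\eta\rho(x)+(1-\eta)\rho(y)$ for $\eta\in L^0(\mathcal F)$, $0\le\eta\le1$, $x,y\in\mathscr X$; $x\le y$ implies $\rho(y)\le\rho(x)$; $\rho(x+\eta)=\rho(x)-\eta$ for $\eta\in L^0(\mathcal F)$, $x\in\mathscr X$. Fenchel transform: $\rho^\#(y):=\sup\{\mathbb E_{\mathbb P}[xy|\mathcal F]-\rho(x):x\in\mathscr X\}\in\overline{L^0}(\mathcal F)$ for $y$ in the Köthe dual module $\mathscr X^\#:=\{y\in L^0(\mathcal E):xy\in L^1_{\mathcal F}(\mathcal E)\ \forall x\in\mathscr X\}$, which is $L^q_{\mathcal F}(\mathcal E)$. Lebesgue property: $\lim_nx_n=x$ a.s. ($x_n,x\in\mathscr X$), $y\in\mathscr X$, $|x_n|\le y$ for all $n$ imply $\lim_n\rho(x_n)=\rho(x)$ a.s. *)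

theory Defs
  imports "HOL-Probability.Probability"
begin

text \<open>
  Throughout, \<open>M\<close> is the probability space, \<open>F\<close> a sub-sigma-algebra of it (\<open>subalgebra M F\<close>).
  Elements of \<open>L\<^sup>0\<close> are represented by measurable functions; equalities, inequalities and limits
  between them are required almost everywhere, and elements of \<open>L\<^sup>0(F)\<close> are represented by
  functions that are measurable with respect to \<open>F\<close> itself.
\<close>

text \<open>
  The two limits exist almost everywhere by monotonicity. The difference is meaningful where at
  least one of them is finite (\<open>\<infinity> - \<infinity> = \<infinity>\<close> in type \<^typ>\<open>ereal\<close>).
\<close>

definition ext_cond_exp :: "'a measure \<Rightarrow> 'a measure \<Rightarrow> ('a \<Rightarrow> real) \<Rightarrow> 'a \<Rightarrow> ereal" where
  "ext_cond_exp M F x = (\<lambda>\<omega>.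
     lim (\<lambda>n. ereal (real_cond_exp M F (\<lambda>w. min (max (x w) 0) (real n)) \<omega>)) -
     lim (\<lambda>n. ereal (real_cond_exp M F (\<lambda>w. min (max (- x w) 0) (real n)) \<omega>)))"

definition L_cond :: "'a measure \<Rightarrow> 'a measure \<Rightarrow> ennreal \<Rightarrow> ('a \<Rightarrow> real) set" where
  "L_cond M F r =
     (if r = \<infinity>
      then {x \<in> borel_measurable M. \<exists>\<eta> \<in> borel_measurable F. AE \<omega> in M. \<bar>x \<omega>\<bar> \<le> \<eta> \<omega>}
      else {x \<in> borel_measurable M.
              AE \<omega> in M. ext_cond_exp M F (\<lambda>w. \<bar>x w\<bar> powr enn2real r) \<omega> < \<infinity>})"

definition holder_conjugate :: "ennreal \<Rightarrow> ennreal \<Rightarrow> bool" where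
  "holder_conjugate p q \<longleftrightarrow> 1 \<le> p \<and> 1 \<le> q \<and> 1 / p + 1 / q = 1"

definition kothe_dual :: "'a measure \<Rightarrow> 'a measure \<Rightarrow> ('a \<Rightarrow> real) set \<Rightarrow> ('a \<Rightarrow> real) set" where
  "kothe_dual M F X =
     {y \<in> borel_measurable M. \<forall>x\<in>X. (\<lambda>\<omega>. x \<omega> * y \<omega>) \<in> L_cond M F 1}"

definition is_ess_sup ::
  "'a measure \<Rightarrow> 'a measure \<Rightarrow> ('a \<Rightarrow> ereal) set \<Rightarrow> ('a \<Rightarrow> ereal) \<Rightarrow> bool" where
  "is_ess_sup M F A s \<longleftrightarrow>
     s \<in> borel_measurable F \<and>
     (\<forall>f\<in>A. AE \<omega> in M. f \<omega> \<le> s \<omega>) \<and>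
     (\<forall>t \<in> borel_measurable F. (\<forall>f\<in>A. AE \<omega> in M. f \<omega> \<le> t \<omega>) \<longrightarrow> (AE \<omega> in M. s \<omega> \<le> t \<omega>))"

text \<open>
  The essential supremum exists for every family on a probability space and is unique up to
  almost-everywhere equality; \<open>ess_sup\<close> selects a representative.
\<close>

definition ess_sup :: "'a measure \<Rightarrow> 'a measure \<Rightarrow> ('a \<Rightarrow> ereal) set \<Rightarrow> 'a \<Rightarrow> ereal" where
  "ess_sup M F A = (SOME s. is_ess_sup M F A s)"

definition fenchel_transform ::
  "'a measure \<Rightarrow> 'a measure \<Rightarrow> ('a \<Rightarrow> real) set \<Rightarrow> (('a \<Rightarrow> real) \<Rightarrow> 'a \<Rightarrow> real)
    \<Rightarrow> ('a \<Rightarrow> real) \<Rightarrow> 'a \<Rightarrow> ereal" where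
  "fenchel_transform M F X \<rho> = (\<lambda>y \<in> kothe_dual M F X.
     ess_sup M F ((\<lambda>x \<omega>. ext_cond_exp M F (\<lambda>w. x w * y w) \<omega> - ereal (\<rho> x \<omega>)) ` X))"

text \<open>
  The monotonicity clause makes \<open>\<rho>\<close> respect almost-everywhere equality on \<open>X\<close>, so that it is
  a map of equivalence classes.
\<close>

definition cond_risk_measure ::
  "'a measure \<Rightarrow> 'a measure \<Rightarrow> ('a \<Rightarrow> real) set \<Rightarrow> (('a \<Rightarrow> real) \<Rightarrow> 'a \<Rightarrow> real) \<Rightarrow> bool" where
  "cond_risk_measure M F X \<rho> \<longleftrightarrow>
     (\<forall>x\<in>X. \<rho> x \<in> borel_measurable F) \<and>
     (\<forall>\<eta> \<in> borel_measurable F. \<forall>x\<in>X. \<forall>y\<in>X. (AE \<omega> in M. 0 \<le> \<eta> \<omega> \<and> \<eta> \<omega> \<le> 1) \<longrightarrow>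
        (AE \<omega> in M. \<rho> (\<lambda>w. \<eta> w * x w + (1 - \<eta> w) * y w) \<omega> \<le> \<eta> \<omega> * \<rho> x \<omega> + (1 - \<eta> \<omega>) * \<rho> y \<omega>)) \<and>
     (\<forall>x\<in>X. \<forall>y\<in>X. (AE \<omega> in M. x \<omega> \<le> y \<omega>) \<longrightarrow> (AE \<omega> in M. \<rho> y \<omega> \<le> \<rho> x \<omega>)) \<and>
     (\<forall>\<eta> \<in> borel_measurable F. \<forall>x\<in>X. AE \<omega> in M. \<rho> (\<lambda>w. x w + \<eta> w) \<omega> = \<rho> x \<omega> - \<eta> \<omega>)"

definition lebesgue_property ::
  "'a measure \<Rightarrow> ('a \<Rightarrow> real) set \<Rightarrow> (('a \<Rightarrow> real) \<Rightarrow> 'a \<Rightarrow> real) \<Rightarrow> bool" where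
  "lebesgue_property M X \<rho> \<longleftrightarrow>
     (\<forall>xs x y. (\<forall>n::nat. xs n \<in> X) \<longrightarrow> x \<in> X \<longrightarrow> y \<in> X \<longrightarrow>
        (AE \<omega> in M. (\<lambda>n. xs n \<omega>) \<longlonglongrightarrow> x \<omega>) \<longrightarrow>
        (\<forall>n. AE \<omega> in M. \<bar>xs n \<omega>\<bar> \<le> y \<omega>) \<longrightarrow>
        (AE \<omega> in M. (\<lambda>n. \<rho> (xs n) \<omega>) \<longlonglongrightarrow> \<rho> x \<omega>))"

end

theory Submission
  imports Defs "HOL-Library.Function_Algebras"
begin

text \<open>
  Continuity is automatic: if \<open>z n\<close> decreases to \<open>0\<close> in \<open>L\<^sup>p\<close>, a subsequence is dominated by
  \<open>2\<^sup>-\<^sup>k W\<close> for one \<open>W\<close> in \<open>L\<^sup>p\<close>, and convexity along the segment from \<open>x\<close> to \<open>x - W\<close> forces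
  \<open>\<rho> (x - z n) \<rightarrow> \<rho> x\<close>. For the dual representation, \<open>d \<mapsto> \<integral> (\<rho> (x + d) - \<rho> x)\<close> is a real convex
  functional on bounded functions, finite because cash invariance bounds the increment by
  \<open>sup |d|\<close>. Hahn-Banach gives a linear functional below it; the Lebesgue property makes this
  functional countably additive, so it has a density \<open>y\<close>. Testing with \<open>1\<^sub>A d\<close>, \<open>A\<close> in \<open>F\<close>, turns the
  scalar inequality into the conditional one, \<open>E[d y | F] \<le> \<rho> (x + d) - \<rho> x\<close>, first for bounded \<open>d\<close>
  and then on all of \<open>L\<^sup>p\<close> by truncation. So \<open>x\<close> attains the supremum defining the Fenchel transform
  at \<open>y\<close>, and \<open>y\<close> lies in the Koethe dual, hence in \<open>L\<^sup>q\<close>.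
\<close>

section \<open>Convex functionals and linear minorants\<close>

text \<open>Elements of L^p_F(E) need not be integrable and \<rho> takes values in L^0(F), so
  neither a norm nor an expectation is available on the whole space. F-measurable weights with
  values in (0,1] repair this: a function is conditionally integrable iff some weight makes it
  integrable, and the weight can be divided out afterwards. Increments of \<rho> in bounded
  directions need no weight, which is why Hahn-Banach is applied only there. The sign of y comes
  from monotonicity of \<rho>, and E[y|F] = -1 from the constant directions 1 and -1. Finiteness of
  p enters through dominated convergence: weighted p-th moments of a decreasing sequence with limit
  0 and a majorant in L^p tend to 0. The inclusion of the Koethe dual in L^q uses the extremal
  functions of Hoelder's inequality for truncations of y (for p = 1, normalized indicators of {|y| >
  4^k}). On the F-set where y fails to be in L^q they can be scaled so that a single W in L^p
  dominates all of them, and conditional integrability of W y then forces this set to be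
  null.\<close>

locale real_vector_space = vector_space scale
  for scale :: "real \<Rightarrow> 'v::ab_group_add \<Rightarrow> 'v" (infixr "\<odot>" 75)
begin

definition sublinear_on :: "'v set \<Rightarrow> ('v \<Rightarrow> real) \<Rightarrow> bool" where
  "sublinear_on V f \<longleftrightarrow> (\<forall>x\<in>V. \<forall>z\<in>V. f (x + z) \<le> f x + f z) \<and> (\<forall>x\<in>V. \<forall>a>0. f (a \<odot> x) = a * f x)"

lemma sublinear_onD:
  assumes "sublinear_on V f" "x \<in> V"
  shows "z \<in> V \<Longrightarrow> f (x + z) \<le> f x + f z" and "a > 0 \<Longrightarrow> f (a \<odot> x) = a * f x"
  using assms by (auto simp: sublinear_on_def)

lemma sublinear_on_zero:
  assumes "subspace V" "sublinear_on V f"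
  shows "f 0 = 0"
  using sublinear_onD(2)[OF assms(2) subspace_0[OF assms(1)], of 2] by simp

lemma sublinear_on_minus:
  assumes "subspace V" "sublinear_on V f" "x \<in> V"
  shows "- f (- x) \<le> f x"
  using sublinear_onD(1)[OF assms(2,3), of "- x"] sublinear_on_zero[OF assms(1,2)]
    subspace_neg[OF assms(1,3)] by simp

text \<open>If \<open>f\<close> is minimal, the functional constructed here equals \<open>f\<close>, which forces linearity.\<close>

lemma sublinear_on_tilt:
  assumes V: "subspace V" and f: "sublinear_on V f" and x: "x \<in> V"
  obtains g where "sublinear_on V g" "\<And>z. z \<in> V \<Longrightarrow> g z \<le> f z" "g (- x) \<le> - f x"
proof -
  \<comment> \<open>The infimum \<open>g\<close> is the largest sublinear functional below
    \<open>f\<close> whose value at \<open>- x\<close> is at most \<open>- f x\<close>: any such k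
    satisfies k z \<le> k (z + t x) + t k (- x) \<le> f (z + t x) - t f x.\<close>
  define S where "S z = (\<lambda>t. f (z + t \<odot> x) - t * f x) ` {0<..}" for z
  define g where "g z = Inf (S z)" for z
  have tx: "t \<odot> x \<in> V" for t using V x by (rule subspace_scale)
  have S_ne: "S z \<noteq> {}" for z by (auto simp: S_def)
  have bdd: "bdd_below (S z)" if z: "z \<in> V" for z
  proof (rule bdd_belowI)
    fix s assume "s \<in> S z"
    then obtain t where t: "t > 0" "s = f (z + t \<odot> x) - t * f x" by (auto simp: S_def)
    have "f ((z + t \<odot> x) + - z) \<le> f (z + t \<odot> x) + f (- z)"
      by (rule sublinear_onD(1)[OF f]) (use V z tx in \<open>auto intro: subspace_add subspace_neg\<close>)
    then show "- f (- z) \<le> s" using t sublinear_onD(2)[OF f x t(1)] by simp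
  qed
  have g_le: "g z \<le> f (z + t \<odot> x) - t * f x" if "z \<in> V" "t > 0" for z t
    unfolding g_def by (rule cInf_lower[OF _ bdd[OF that(1)]]) (use that in \<open>auto simp: S_def\<close>)
  have g_ge: "c \<le> g z" if "\<And>t. t > 0 \<Longrightarrow> c \<le> f (z + t \<odot> x) - t * f x" for c z
    unfolding g_def by (rule cInf_greatest[OF S_ne]) (use that in \<open>auto simp: S_def\<close>)
  have "sublinear_on V g"
    unfolding sublinear_on_def
  proof (intro conjI ballI allI impI)
    fix z1 z2 assume z: "z1 \<in> V" "z2 \<in> V"
    have *: "g (z1 + z2) \<le> (f (z1 + t \<odot> x) - t * f x) + (f (z2 + s \<odot> x) - s * f x)" if "t > 0" "s > 0" for t s
    proof -
      have "g (z1 + z2) \<le> f ((z1 + z2) + (t + s) \<odot> x) - (t + s) * f x"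
        using that z V by (intro g_le) (auto intro: subspace_add)
      also have "(z1 + z2) + (t + s) \<odot> x = (z1 + t \<odot> x) + (z2 + s \<odot> x)"
        by (simp add: scale_left_distrib)
      also have "f \<dots> \<le> f (z1 + t \<odot> x) + f (z2 + s \<odot> x)"
        using z V tx by (intro sublinear_onD(1)[OF f]) (auto intro: subspace_add)
      finally show ?thesis by (simp add: algebra_simps)
    qed
    \<comment> \<open>The two infima are taken one at a time: over \<open>t\<close> with
      \<open>s\<close> fixed, then over \<open>s\<close>.\<close>
    have "g (z1 + z2) - g z1 \<le> g z2"
    proof (rule g_ge)
      fix s :: real assume s: "s > 0"
      have "g (z1 + z2) - (f (z2 + s \<odot> x) - s * f x) \<le> g z1"
        using *[OF _ s] by (intro g_ge) (simp add: algebra_simps)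
      then show "g (z1 + z2) - g z1 \<le> f (z2 + s \<odot> x) - s * f x" by simp
    qed
    then show "g (z1 + z2) \<le> g z1 + g z2" by simp
  next
    have le: "g (a \<odot> z) \<le> a * g z" if z: "z \<in> V" and a: "a > 0" for a z
    proof -
      have "g (a \<odot> z) / a \<le> g z"
      proof (rule g_ge)
        fix t :: real assume t: "t > 0"
        have "g (a \<odot> z) \<le> f (a \<odot> z + (a * t) \<odot> x) - (a * t) * f x"
          using z V a t by (intro g_le) (auto intro: subspace_scale)
        also have "a \<odot> z + (a * t) \<odot> x = a \<odot> (z + t \<odot> x)" by (simp add: scale_right_distrib)
        also have "f \<dots> = a * f (z + t \<odot> x)"
          using z V tx a by (intro sublinear_onD(2)[OF f]) (auto intro: subspace_add)
        finally show "g (a \<odot> z) / a \<le> f (z + t \<odot> x) - t * f x"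
          using a by (simp add: field_simps)
      qed
      then show ?thesis using a by (simp add: field_simps)
    qed
    fix z and a :: real assume z: "z \<in> V" and a: "a > 0"
    \<comment> \<open>The reverse inequality is \<open>le\<close> for the factor 1/a at the point
      \<open>a \<odot> z\<close>.\<close>
    have "g ((1/a) \<odot> (a \<odot> z)) \<le> (1/a) * g (a \<odot> z)"
      using z a V by (intro le) (auto intro: subspace_scale)
    then have "a * g z \<le> g (a \<odot> z)" using a by (simp add: field_simps)
    with le[OF z a] show "g (a \<odot> z) = a * g z" by simp
  qed
  moreover have "g z \<le> f z" if z: "z \<in> V" for z
  proof -
    have "g z \<le> f (z + 1 \<odot> x) - 1 * f x" using z by (intro g_le) auto
    also have "\<dots> \<le> f z" using sublinear_onD(1)[OF f z x] by simp
    finally show ?thesis .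
  qed
  moreover have "g (- x) \<le> - f x"
  proof -
    have "g (- x) \<le> f (- x + 1 \<odot> x) - 1 * f x" using x V by (intro g_le) (auto intro: subspace_neg)
    then show ?thesis using sublinear_on_zero[OF V f] by simp
  qed
  ultimately show thesis by (rule that)
qed

text \<open>Zorn's lemma for the reversed pointwise order. The pointwise infimum of a chain stays
  finite because every sublinear g \<le> f satisfies - f (- x) \<le> - g (- x) \<le> g x.\<close>

lemma sublinear_on_minimal:
  assumes V: "subspace V" and f: "sublinear_on V f"
  obtains m where "sublinear_on V m" "\<And>x. x \<in> V \<Longrightarrow> m x \<le> f x"
    "\<And>g x. sublinear_on V g \<Longrightarrow> (\<And>x. x \<in> V \<Longrightarrow> g x \<le> m x) \<Longrightarrow> x \<in> V \<Longrightarrow> g x = m x"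
proof -
  define A where "A = {g. sublinear_on V g \<and> (\<forall>x\<in>V. g x \<le> f x) \<and> (\<forall>x. x \<notin> V \<longrightarrow> g x = 0)}"
  define P :: "('v \<Rightarrow> real) \<Rightarrow> ('v \<Rightarrow> real) \<Rightarrow> bool" where "P g k \<longleftrightarrow> (\<forall>x\<in>V. k x \<le> g x)" for g k
  \<comment> \<open>The order \<open>P\<close> sees values on \<open>V\<close> only. Prescribing 0
    outside \<open>V\<close> makes it antisymmetric with respect to equality of functions.\<close>
  define cut where "cut g x = (if x \<in> V then g x else 0)" for g :: "'v \<Rightarrow> real" and x
  have sub_cut: "sublinear_on V (cut g)" if "sublinear_on V g" for g
    using that V by (auto simp: sublinear_on_def cut_def subspace_add subspace_scale)
  have cut_A: "cut g \<in> A" if "sublinear_on V g" "\<And>x. x \<in> V \<Longrightarrow> g x \<le> f x" for g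
    using that sub_cut[OF that(1)] by (auto simp: A_def cut_def)
  have "\<exists>m\<in>A. \<forall>g\<in>A. P m g \<longrightarrow> g = m"
  proof (rule predicate_Zorn)
    show "partial_order_on A (relation_of P A)"
    proof (rule partial_order_on_relation_ofI)
      show "P a a" for a by (simp add: P_def)
      show "P a c" if "P a b" "P b c" for a b c using that by (force simp: P_def)
      show "a = b" if "a \<in> A" "b \<in> A" "P a b" "P b a" for a b
      proof
        show "a x = b x" for x
        proof (cases "x \<in> V")
          case True
          then show ?thesis using that by (auto simp: P_def intro: antisym)
        next
          case False
          then show ?thesis using that by (auto simp: A_def)
        qed
      qed
    qed
  next
    fix C assume C: "C \<in> Chains (relation_of P A)"
    show "\<exists>u\<in>A. \<forall>a\<in>C. P a u"
    proof (cases "C = {}")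
      case True
      then show ?thesis using cut_A[OF f] by auto
    next
      case False
      have CA: "g \<in> A" if "g \<in> C" for g using C that by (auto simp: Chains_def relation_of_def)
      have chain: "P g k \<or> P k g" if "g \<in> C" "k \<in> C" for g k
        using C that by (auto simp: Chains_def relation_of_def)
      have sub: "sublinear_on V g" if "g \<in> C" for g using CA[OF that] by (simp add: A_def)
      have bdd: "bdd_below ((\<lambda>g. g x) ` C)" if x: "x \<in> V" for x
      proof (rule bdd_belowI2)
        fix g assume g: "g \<in> C"
        have "- f (- x) \<le> - g (- x)" using CA[OF g] subspace_neg[OF V x] by (auto simp: A_def)
        also have "\<dots> \<le> g x" by (rule sublinear_on_minus[OF V sub[OF g] x])
        finally show "- f (- x) \<le> g x" .
      qed
      define u where "u x = (INF g\<in>C. g x)" for x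
      have u_le: "u x \<le> g x" if "x \<in> V" "g \<in> C" for x g
        unfolding u_def by (rule cINF_lower[OF bdd]) (use that in auto)
      have u_ge: "c \<le> u x" if "\<And>g. g \<in> C \<Longrightarrow> c \<le> g x" for c x
        unfolding u_def by (rule cINF_greatest) (use False that in auto)
      have "sublinear_on V u"
        unfolding sublinear_on_def
      proof (intro conjI ballI allI impI)
        fix x z assume xz: "x \<in> V" "z \<in> V"
        have *: "u (x + z) \<le> g x + k z" if gk: "g \<in> C" "k \<in> C" for g k
        proof -
          \<comment> \<open>Of two comparable members the smaller one lies below \<open>g\<close> at
            \<open>x\<close> and below \<open>k\<close> at \<open>z\<close> simultaneously. This
            makes the infimum subadditive.\<close>
          obtain l where l: "l \<in> C" "l x \<le> g x" "l z \<le> k z"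
            using chain[OF gk] gk xz by (auto simp: P_def)
          have "u (x + z) \<le> l (x + z)" using V xz l by (intro u_le) (auto intro: subspace_add)
          also have "\<dots> \<le> l x + l z" using sublinear_onD(1)[OF sub[OF l(1)]] xz by auto
          finally show ?thesis using l by simp
        qed
        have "u (x + z) - u x \<le> u z"
        proof (rule u_ge)
          fix k assume k: "k \<in> C"
          have "u (x + z) - k z \<le> u x"
            using *[OF _ k] by (intro u_ge) (simp add: algebra_simps)
          then show "u (x + z) - u x \<le> k z" by simp
        qed
        then show "u (x + z) \<le> u x + u z" by simp
      next
        fix x and a :: real assume x: "x \<in> V" and a: "a > 0"
        have ax: "a \<odot> x \<in> V" using V x by (rule subspace_scale)
        have hom: "g (a \<odot> x) = a * g x" if "g \<in> C" for g
          using sublinear_onD(2)[OF sub[OF that] x a] .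
        have "u (a \<odot> x) / a \<le> u x"
        proof (rule u_ge)
          fix g assume g: "g \<in> C"
          show "u (a \<odot> x) / a \<le> g x" using u_le[OF ax g] hom[OF g] a by (simp add: field_simps)
        qed
        moreover have "a * u x \<le> u (a \<odot> x)"
        proof (rule u_ge)
          fix g assume g: "g \<in> C"
          show "a * u x \<le> g (a \<odot> x)" using u_le[OF x g] hom[OF g] a by simp
        qed
        ultimately show "u (a \<odot> x) = a * u x" using a by (simp add: field_simps)
      qed
      moreover have "u x \<le> f x" if x: "x \<in> V" for x
      proof -
        obtain g where g: "g \<in> C" using False by auto
        show ?thesis using u_le[OF x g] CA[OF g] x by (force simp: A_def)
      qed
      ultimately have "cut u \<in> A" by (rule cut_A)
      moreover have "\<forall>g\<in>C. P g (cut u)" using u_le by (auto simp: P_def cut_def)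
      ultimately show ?thesis by auto
    qed
  qed
  then obtain m where m: "m \<in> A" and min: "\<And>g. g \<in> A \<Longrightarrow> P m g \<Longrightarrow> g = m" by auto
  show thesis
  proof (rule that)
    show "sublinear_on V m" using m by (simp add: A_def)
    show "m x \<le> f x" if "x \<in> V" for x using m that by (simp add: A_def)
    fix g x assume g: "sublinear_on V g" "\<And>x. x \<in> V \<Longrightarrow> g x \<le> m x" and x: "x \<in> V"
    have "g z \<le> f z" if "z \<in> V" for z
      using g(2)[OF that] m that by (force simp: A_def)
    then have "cut g \<in> A" using g by (intro cut_A) auto
    moreover have "P m (cut g)" using g by (auto simp: P_def cut_def)
    ultimately have "cut g = m" by (rule min)
    then have "cut g x = m x" by simp
    then show "g x = m x" using x by (simp add: cut_def)
  qed
qed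

text \<open>Tilting a minimal functional m at x cannot lower it, so m (- x) \<le> - m x. Hence m is
  odd, and an odd sublinear functional is linear.\<close>

theorem sublinear_on_dominates_linear:
  assumes V: "subspace V" and f: "sublinear_on V f"
  obtains l where "\<And>x. x \<in> V \<Longrightarrow> l x \<le> f x" "\<And>x z. x \<in> V \<Longrightarrow> z \<in> V \<Longrightarrow> l (x + z) = l x + l z"
    "\<And>a x. x \<in> V \<Longrightarrow> l (a \<odot> x) = a * l x"
proof -
  obtain m where m: "sublinear_on V m" "\<And>x. x \<in> V \<Longrightarrow> m x \<le> f x"
    and min: "\<And>g x. sublinear_on V g \<Longrightarrow> (\<And>x. x \<in> V \<Longrightarrow> g x \<le> m x) \<Longrightarrow> x \<in> V \<Longrightarrow> g x = m x"
    by (rule sublinear_on_minimal[OF V f]) blast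
  have neg: "m (- x) = - m x" if x: "x \<in> V" for x
  proof -
    obtain g where g: "sublinear_on V g" "\<And>z. z \<in> V \<Longrightarrow> g z \<le> m z" "g (- x) \<le> - m x"
      by (rule sublinear_on_tilt[OF V m(1) x]) blast
    have "m (- x) \<le> - m x" using min[OF g(1,2), of "- x"] g(3) subspace_neg[OF V x] by simp
    moreover have "- m (- x) \<le> m x" by (rule sublinear_on_minus[OF V m(1) x])
    ultimately show ?thesis by simp
  qed
  have add: "m (x + z) = m x + m z" if xz: "x \<in> V" "z \<in> V" for x z
  proof -
    have "m ((x + z) + - z) \<le> m (x + z) + m (- z)"
      using xz V by (intro sublinear_onD(1)[OF m(1)]) (auto intro: subspace_add subspace_neg)
    then show ?thesis using neg[OF xz(2)] sublinear_onD(1)[OF m(1) xz] by simp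
  qed
  have hom: "m (a \<odot> x) = a * m x" if x: "x \<in> V" for a x
  proof -
    consider "a > 0" | "a = 0" | "a < 0" by linarith
    then show ?thesis
    proof cases
      case 1
      then show ?thesis using sublinear_onD(2)[OF m(1) x] by simp
    next
      case 2
      then show ?thesis using sublinear_on_zero[OF V m(1)] by simp
    next
      case 3
      have "m (- ((- a) \<odot> x)) = - m ((- a) \<odot> x)"
        using V x by (intro neg subspace_scale)
      then show ?thesis using sublinear_onD(2)[OF m(1) x, of "- a"] 3 by simp
    qed
  qed
  show thesis using m(2) add hom by (rule that)
qed

text \<open>Reduction to the sublinear case: the infimum over t > 0 of r (t x) / t is the
  directional derivative of \<open>r\<close> at 0. It is sublinear, and t = 1 shows that it lies
  below \<open>r\<close>.\<close>

corollary convex_dominates_linear: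
  assumes V: "subspace V" and r0: "r 0 = 0"
    and conv: "\<And>x z t. x \<in> V \<Longrightarrow> z \<in> V \<Longrightarrow> 0 \<le> t \<Longrightarrow> t \<le> 1 \<Longrightarrow> r (t \<odot> x + (1 - t) \<odot> z) \<le> t * r x + (1 - t) * r z"
  obtains l where "\<And>x. x \<in> V \<Longrightarrow> l x \<le> r x" "\<And>x z. x \<in> V \<Longrightarrow> z \<in> V \<Longrightarrow> l (x + z) = l x + l z"
    "\<And>a x. x \<in> V \<Longrightarrow> l (a \<odot> x) = a * l x"
proof -
  define S where "S x = (\<lambda>t. r (t \<odot> x) / t) ` {0<..}" for x
  define f where "f x = Inf (S x)" for x
  have tx: "t \<odot> x \<in> V" if "x \<in> V" for t x using V that by (rule subspace_scale)
  have S_ne: "S x \<noteq> {}" for x by (auto simp: S_def)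
  \<comment> \<open>The weights t/(s+t) and s/(s+t) are chosen so that s x and t z enter with the
    same coefficient st/(s+t). Dividing by that coefficient gives \<open>quot\<close>.\<close>
  have r_add: "r ((s * t / (s + t)) \<odot> (x + z)) \<le> t / (s + t) * r (s \<odot> x) + s / (s + t) * r (t \<odot> z)"
    if "x \<in> V" "z \<in> V" "s > 0" "t > 0" for x z s t
  proof -
    have "r ((t / (s + t)) \<odot> (s \<odot> x) + (1 - t / (s + t)) \<odot> (t \<odot> z))
        \<le> t / (s + t) * r (s \<odot> x) + (1 - t / (s + t)) * r (t \<odot> z)"
      using that by (intro conv tx) (auto simp: field_simps)
    moreover have "1 - t / (s + t) = s / (s + t)" using that by (simp add: field_simps)
    ultimately show ?thesis by (simp add: scale_right_distrib mult.commute)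
  qed
  have ratio: "(t / u * a + s / u * b) / (s * t / u) = a / s + b / t"
    if "u \<noteq> 0" "s \<noteq> 0" "t \<noteq> 0" for u s t a b :: real
    using that by (simp add: field_simps)
  have quot: "r ((s * t / (s + t)) \<odot> (x + z)) / (s * t / (s + t)) \<le> r (s \<odot> x) / s + r (t \<odot> z) / t"
    if "x \<in> V" "z \<in> V" "s > 0" "t > 0" for x z s t
  proof -
    have "r ((s * t / (s + t)) \<odot> (x + z)) / (s * t / (s + t))
        \<le> (t / (s + t) * r (s \<odot> x) + s / (s + t) * r (t \<odot> z)) / (s * t / (s + t))"
      using r_add[OF that] that by (intro divide_right_mono) auto
    also have "\<dots> = r (s \<odot> x) / s + r (t \<odot> z) / t"
      using that ratio[of "s + t" s t] by simp
    finally show ?thesis .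
  qed
  have bdd: "bdd_below (S x)" if x: "x \<in> V" for x
  proof (rule bdd_belowI)
    fix c assume "c \<in> S x"
    then obtain t where t: "t > 0" "c = r (t \<odot> x) / t" by (auto simp: S_def)
    \<comment> \<open>\<open>quot\<close> for the pair x, -x, whose sum is 0, where \<open>r\<close>
      vanishes.\<close>
    have "0 \<le> r (t \<odot> x) / t + r (1 \<odot> (- x)) / 1"
      using quot[OF x subspace_neg[OF V x] t(1), of 1] r0 by simp
    then show "- r (- x) \<le> c" using t by simp
  qed
  have f_le: "f x \<le> r (t \<odot> x) / t" if "x \<in> V" "t > 0" for x t
    unfolding f_def by (rule cInf_lower[OF _ bdd[OF that(1)]]) (use that in \<open>auto simp: S_def\<close>)
  have f_ge: "c \<le> f x" if "\<And>t. t > 0 \<Longrightarrow> c \<le> r (t \<odot> x) / t" for c x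
    unfolding f_def by (rule cInf_greatest[OF S_ne]) (use that in \<open>auto simp: S_def\<close>)
  have "sublinear_on V f"
    unfolding sublinear_on_def
  proof (intro conjI ballI allI impI)
    fix x z assume xz: "x \<in> V" "z \<in> V"
    have *: "f (x + z) \<le> r (s \<odot> x) / s + r (t \<odot> z) / t" if st: "s > 0" "t > 0" for s t
      using f_le[OF subspace_add[OF V xz], of "s * t / (s + t)"] quot[OF xz st] st by simp
    have "f (x + z) - f x \<le> f z"
    proof (rule f_ge)
      fix t :: real assume t: "t > 0"
      have "f (x + z) - r (t \<odot> z) / t \<le> f x"
        using *[OF _ t] by (intro f_ge) (simp add: algebra_simps)
      then show "f (x + z) - f x \<le> r (t \<odot> z) / t" by simp
    qed
    then show "f (x + z) \<le> f x + f z" by simp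
  next
    have le: "f (a \<odot> z) \<le> a * f z" if z: "z \<in> V" and a: "a > 0" for a z
    proof -
      have "f (a \<odot> z) / a \<le> f z"
      proof (rule f_ge)
        fix t :: real assume t: "t > 0"
        have "f (a \<odot> z) \<le> r ((t / a) \<odot> (a \<odot> z)) / (t / a)"
          using z a t by (intro f_le tx) auto
        then show "f (a \<odot> z) / a \<le> r (t \<odot> z) / t" using a by (simp add: field_simps)
      qed
      then show ?thesis using a by (simp add: field_simps)
    qed
    fix z and a :: real assume z: "z \<in> V" and a: "a > 0"
    have "f ((1/a) \<odot> (a \<odot> z)) \<le> (1/a) * f (a \<odot> z)"
      using z a by (intro le tx) auto
    then have "a * f z \<le> f (a \<odot> z)" using a by (simp add: field_simps)
    with le[OF z a] show "f (a \<odot> z) = a * f z" by simp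
  qed
  then obtain l where l: "\<And>x. x \<in> V \<Longrightarrow> l x \<le> f x"
    "\<And>x z. x \<in> V \<Longrightarrow> z \<in> V \<Longrightarrow> l (x + z) = l x + l z" "\<And>a x. x \<in> V \<Longrightarrow> l (a \<odot> x) = a * l x"
    using sublinear_on_dominates_linear[OF V] by blast
  have "l x \<le> r x" if x: "x \<in> V" for x
    using l(1)[OF x] f_le[OF x, of 1] by simp
  then show thesis using l(2,3) by (rule that)
qed

end

section \<open>Densities of positive functionals\<close>

text \<open>The set function A \<mapsto> m(1_A) is a finite measure that is absolutely continuous
  with respect to \<open>M\<close>; \<open>cont\<close> supplies both countable additivity and the
  vanishing on null sets. Its Radon-Nikodym density represents \<open>m\<close> on indicators, hence
  on simple functions by linearity, and on bounded functions because both sides are continuous under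
  bounded convergence.\<close>

lemma (in finite_measure) positive_functional_has_density:
  fixes m :: "('a \<Rightarrow> real) \<Rightarrow> real"
  defines "V \<equiv> {d \<in> borel_measurable M. \<exists>K. \<forall>w. \<bar>d w\<bar> \<le> K}"
  assumes add: "\<And>d e. d \<in> V \<Longrightarrow> e \<in> V \<Longrightarrow> m (\<lambda>w. d w + e w) = m d + m e"
    and cmult: "\<And>c d. d \<in> V \<Longrightarrow> m (\<lambda>w. c * d w) = c * m d"
    and pos: "\<And>d. d \<in> V \<Longrightarrow> (\<And>w. 0 \<le> d w) \<Longrightarrow> 0 \<le> m d"
    and cont: "\<And>d K. (\<And>n. d n \<in> borel_measurable M) \<Longrightarrow> (\<And>n w. \<bar>d n w\<bar> \<le> K) \<Longrightarrow>
      AE w in M. (\<lambda>n. d n w) \<longlonglongrightarrow> 0 \<Longrightarrow> (\<lambda>n. m (d n)) \<longlonglongrightarrow> 0"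
  obtains y where "y \<in> borel_measurable M" "\<And>w. 0 \<le> y w" "integrable M y"
    "\<And>d. d \<in> V \<Longrightarrow> m d = (\<integral>w. d w * y w \<partial>M)"
proof -
  have VI: "d \<in> V" if "d \<in> borel_measurable M" "\<And>w. \<bar>d w\<bar> \<le> K" for d K
    using that by (auto simp: V_def)
  have ind_V: "indicator A \<in> V" if "A \<in> sets M" for A
    using that by (intro VI[of _ 1]) (auto simp: indicator_def)
  have ind_pos: "0 \<le> m (indicator A)" if "A \<in> sets M" for A
    using that by (intro pos ind_V) auto
  have zero: "m (\<lambda>w. 0) = 0" using cmult[of "\<lambda>w. 0" 0] VI[of "\<lambda>w. 0" 0] by simp
  have null: "m (indicator A) = 0" if "A \<in> null_sets M" for A
  proof -
    \<comment> \<open>A constant sequence: the indicator of a null set already converges to 0 almost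
      everywhere.\<close>
    have "(\<lambda>n::nat. m (indicator A)) \<longlonglongrightarrow> 0"
    proof (rule cont[of _ 1])
      show "AE w in M. (\<lambda>n. indicator A w :: real) \<longlonglongrightarrow> 0"
        using AE_not_in[OF that] by eventually_elim auto
    qed (use that in \<open>auto simp: indicator_def\<close>)
    then show ?thesis by (simp add: LIMSEQ_const_iff)
  qed
  define \<mu> where "\<mu> A = ennreal (m (indicator A))" for A
  have ca: "countably_additive (sets M) \<mu>"
  proof (rule countably_additiveI)
    fix A :: "nat \<Rightarrow> 'a set" assume A: "range A \<subseteq> sets M" "disjoint_family A"
    \<comment> \<open>The tails decrease to the empty set, so \<open>cont\<close> sends their values
      to 0, and m(1_{A n}) is the difference of two consecutive tails. The series therefore
      telescopes.\<close>
    define T where "T n = (\<Union>i\<in>{n..}. A i)" for n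
    have AM[measurable]: "A n \<in> sets M" for n using A by auto
    have TM[measurable]: "T n \<in> sets M" for n unfolding T_def by measurable
    have T_Suc: "T n = A n \<union> T (Suc n)" for n
    proof -
      have eq: "{n..} = insert n {Suc n..}" by auto
      show ?thesis unfolding T_def by (subst eq) simp
    qed
    have A_disj: "A i \<inter> A j = {}" if "i \<noteq> j" for i j
      using disjoint_family_onD[OF A(2)] that by blast
    have disj: "A n \<inter> T (Suc n) = {}" for n
    proof -
      have "A n \<inter> A i = {}" if "i \<in> {Suc n..}" for i using that by (intro A_disj) auto
      then show ?thesis unfolding T_def by blast
    qed
    have step: "m (indicator (T n)) = m (indicator (A n)) + m (indicator (T (Suc n)))" for n
    proof -
      have "(indicator (T n) :: 'a \<Rightarrow> real) = (\<lambda>w. indicator (A n) w + indicator (T (Suc n)) w)"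
        using disj[of n] by (subst T_Suc) (auto simp: fun_eq_iff indicator_def)
      then show ?thesis using add[of "indicator (A n)" "indicator (T (Suc n))"] ind_V by simp
    qed
    have "(\<lambda>n. m (indicator (T n))) \<longlonglongrightarrow> 0"
    proof (rule cont[of _ 1])
      have "(\<lambda>n. indicator (T n) w :: real) \<longlonglongrightarrow> 0" for w
      proof (cases "\<exists>i. w \<in> A i")
        case True
        then obtain i where i: "w \<in> A i" by blast
        have "w \<notin> T n" if "n > i" for n
        proof
          assume "w \<in> T n"
          then obtain j where "n \<le> j" "w \<in> A j" by (auto simp: T_def)
          then show False using A_disj[of i j] i that by auto
        qed
        then have "eventually (\<lambda>n. indicator (T n) w = (0 :: real)) sequentially"
          by (auto simp: eventually_sequentially intro!: exI[of _ "Suc i"])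
        then show ?thesis by (rule tendsto_eventually)
      next
        case False
        then have "indicator (T n) w = (0 :: real)" for n by (auto simp: T_def)
        then show ?thesis by simp
      qed
      then show "AE w in M. (\<lambda>n. indicator (T n) w :: real) \<longlonglongrightarrow> 0" by simp
    qed (auto simp: indicator_def)
    from telescope_sums'[OF this] have "(\<lambda>n. m (indicator (T n)) - m (indicator (T (Suc n)))) sums m (indicator (T 0))"
      by simp
    moreover have "m (indicator (T n)) - m (indicator (T (Suc n))) = m (indicator (A n))" for n
      using step[of n] by simp
    ultimately have "(\<lambda>n. m (indicator (A n))) sums m (indicator (T 0))" by simp
    moreover have "T 0 = (\<Union>i. A i)" by (auto simp: T_def)
    ultimately show "(\<Sum>i. \<mu> (A i)) = \<mu> (\<Union>i. A i)"
      unfolding \<mu>_def by (intro suminf_ennreal_eq) (auto intro: ind_pos)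
  qed
  define N where "N = measure_of (space M) (sets M) \<mu>"
  have sets_N[simp]: "sets N = sets M" and space_N: "space N = space M" by (simp_all add: N_def)
  have em_N: "emeasure N A = \<mu> A" if "A \<in> sets M" for A
  proof -
    have "positive (sets M) \<mu>"
      using null[of "{}"] by (simp add: positive_def \<mu>_def)
    with ca that show ?thesis by (simp add: N_def emeasure_measure_of_sigma sets.sigma_algebra_axioms)
  qed
  have "finite_measure N"
    by (rule finite_measureI) (simp add: space_N em_N \<mu>_def)
  moreover have "absolutely_continuous M N"
    unfolding absolutely_continuous_def
  proof
    fix A assume A: "A \<in> null_sets M"
    then have "A \<in> sets M" by auto
    then show "A \<in> null_sets N" using null[OF A] by (auto intro!: null_setsI simp: em_N \<mu>_def)
  qed
  ultimately obtain f where f[measurable]: "f \<in> borel_measurable M" and dens: "density M f = N"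
    using Radon_Nikodym_finite_measure[of N] by auto
  have f_int: "(\<integral>\<^sup>+ w. f w * indicator A w \<partial>M) = \<mu> A" if "A \<in> sets M" for A
    using that em_N[OF that] emeasure_density[OF f that] dens by simp
  have f_total: "(\<integral>\<^sup>+ w. f w \<partial>M) = \<mu> (space M)"
    using f_int[of "space M"] by (simp cong: nn_integral_cong_simp)
  then have "(\<integral>\<^sup>+ w. f w \<partial>M) \<noteq> \<infinity>" by (simp add: \<mu>_def)
  then have f_fin: "AE w in M. f w = ennreal (enn2real (f w))"
    using nn_integral_noteq_infinite[OF f] by (auto elim!: eventually_mono simp: less_top)
  define y where "y w = enn2real (f w)" for w
  have [measurable]: "y \<in> borel_measurable M" by (simp add: y_def[abs_def])
  have y0: "0 \<le> y w" for w by (simp add: y_def)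
  have y_int: "(\<integral>\<^sup>+ w. ennreal (indicator A w * y w) \<partial>M) = \<mu> A" if "A \<in> sets M" for A
  proof -
    have "(\<integral>\<^sup>+ w. ennreal (indicator A w * y w) \<partial>M) = (\<integral>\<^sup>+ w. f w * indicator A w \<partial>M)"
      using f_fin by (intro nn_integral_cong_AE) (auto elim!: eventually_mono simp: y_def split: split_indicator)
    then show ?thesis using f_int[OF that] by simp
  qed
  have integrable_y: "integrable M y"
  proof (rule integrableI_nonneg)
    have "(\<integral>\<^sup>+ w. ennreal (y w) \<partial>M) = \<mu> (space M)"
      using y_int[of "space M"] by (simp cong: nn_integral_cong_simp)
    then show "(\<integral>\<^sup>+ w. ennreal (y w) \<partial>M) < \<infinity>" by (simp add: \<mu>_def)
  qed (use y0 in auto)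
  have ind_eq: "m (indicator A) = (\<integral>w. indicator A w * y w \<partial>M)" if A: "A \<in> sets M" for A
    using y_int[OF A] A y0 ind_pos[OF A] by (subst integral_eq_nn_integral) (auto simp: \<mu>_def)
  have int_V: "integrable M (\<lambda>w. d w * y w)" if d: "d \<in> V" for d
  proof -
    obtain K where K: "\<And>w. \<bar>d w\<bar> \<le> K" and [measurable]: "d \<in> borel_measurable M" using d by (auto simp: V_def)
    show ?thesis
    proof (rule Bochner_Integration.integrable_bound[of M "\<lambda>w. K * y w"])
      show "integrable M (\<lambda>w. K * y w)" using integrable_y by simp
      show "AE w in M. norm (d w * y w) \<le> norm (K * y w)"
      proof (rule AE_I2)
        fix w
        have "\<bar>d w\<bar> * y w \<le> \<bar>K\<bar> * y w" using K[of w] y0 by (intro mult_right_mono) auto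
        then show "norm (d w * y w) \<le> norm (K * y w)" using y0[of w] by (simp add: abs_mult)
      qed
    qed measurable
  qed
  \<comment> \<open>The defect of the representation. It is linear and zero on indicators; what
    remains is to show that it vanishes on \<open>V\<close>.\<close>
  define D where "D d = m d - (\<integral>w. d w * y w \<partial>M)" for d
  have D_add: "D (\<lambda>w. d w + e w) = D d + D e" if "d \<in> V" "e \<in> V" for d e
    using that by (simp add: D_def add int_V distrib_right)
  have D_cmult: "D (\<lambda>w. c * d w) = c * D d" if "d \<in> V" for c d
    using that by (simp add: D_def cmult int_V mult.assoc right_diff_distrib)
  \<comment> \<open>Membership in \<open>V\<close> is carried through the induction because
    additivity of \<open>D\<close> is available only inside \<open>V\<close>.\<close>
  have D_sum: "(\<lambda>w. \<Sum>a\<in>S. a * indicator (B a) w) \<in> V \<and> D (\<lambda>w. \<Sum>a\<in>S. a * indicator (B a) w) = 0"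
    if "finite S" "\<And>a. a \<in> S \<Longrightarrow> B a \<in> sets M" for S :: "real set" and B
    using that
  proof (induction S)
    case empty
    then show ?case using VI[of "\<lambda>w. 0" 0] zero by (simp add: D_def)
  next
    case (insert a S)
    let ?g = "\<lambda>w. \<Sum>a\<in>S. a * indicator (B a) w"
    have g: "?g \<in> V" "D ?g = 0" using insert by auto
    have ia: "indicator (B a) \<in> V" using insert by (intro ind_V) auto
    have aV: "(\<lambda>w. a * indicator (B a) w) \<in> V"
      using insert by (intro VI[of _ "\<bar>a\<bar>"]) (auto simp: indicator_def)
    have "D (\<lambda>w. a * indicator (B a) w) = 0"
      using D_cmult[OF ia, of a] ind_eq[of "B a"] insert by (simp add: D_def)
    moreover have "(\<lambda>w. a * indicator (B a) w + ?g w) \<in> V"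
    proof -
      obtain K where "\<And>w. \<bar>?g w\<bar> \<le> K" "?g \<in> borel_measurable M" using g(1) by (auto simp: V_def)
      moreover obtain K' where "\<And>w. \<bar>a * indicator (B a) w\<bar> \<le> K'" "(\<lambda>w. a * indicator (B a) w) \<in> borel_measurable M"
        using aV by (auto simp: V_def)
      ultimately show ?thesis
        by (intro VI[of _ "K' + K"]) (auto intro!: order_trans[OF abs_triangle_ineq] add_mono)
    qed
    moreover have "(\<lambda>w. \<Sum>a\<in>insert a S. a * indicator (B a) w) = (\<lambda>w. a * indicator (B a) w + ?g w)"
      using insert(1,2) by (simp only: sum.insert not_False_eq_True)
    ultimately show ?case using D_add[OF aV g(1)] g(2) by (simp only: add_0)
  qed
  have "m d = (\<integral>w. d w * y w \<partial>M)" if d: "d \<in> V" for d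
  proof -
    obtain K where K: "\<And>w. \<bar>d w\<bar> \<le> K" and dm[measurable]: "d \<in> borel_measurable M"
      using d by (auto simp: V_def)
    obtain s where s: "\<And>i::nat. simple_function M (s i)" "\<And>w. w \<in> space M \<Longrightarrow> (\<lambda>i. s i w) \<longlonglongrightarrow> d w"
      "\<And>i w. w \<in> space M \<Longrightarrow> dist (s i w) 0 \<le> 2 * dist (d w) 0"
      using borel_measurable_implies_sequence_metric[OF dm, of 0] by blast
    \<comment> \<open>The approximations \<open>s i\<close> are controlled on \<open>space M\<close>
      only, whereas \<open>V\<close> asks for a bound at every point of the type. \<open>g i\<close>
      agrees with \<open>s i\<close> on \<open>space M\<close> and is 0 elsewhere.\<close>
    define g where "g i w = (\<Sum>a\<in>s i ` space M. a * indicator (s i -` {a} \<inter> space M) w)" for i w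
    have g_V: "g i \<in> V" and D_g: "D (g i) = 0" for i
      using D_sum[of "s i ` space M" "\<lambda>a. s i -` {a} \<inter> space M"] s(1)[of i]
      by (auto simp: g_def[abs_def] simple_function_def)
    have g_eq: "g i w = s i w" if "w \<in> space M" for i w
    proof -
      have "s i w = (\<Sum>a\<in>s i ` space M. indicator (s i -` {a} \<inter> space M) w *\<^sub>R a)"
        by (rule simple_function_indicator_representation_banach[OF s(1) that])
      also have "\<dots> = g i w" unfolding g_def by (intro sum.cong refl) (simp only: real_scaleR_def mult.commute)
      finally show ?thesis by (rule sym)
    qed
    have g_out: "g i w = 0" if "w \<notin> space M" for i w
      unfolding g_def using that by (intro sum.neutral) auto
    have K0: "0 \<le> K" using K[of undefined] by linarith
    have g_le: "\<bar>g i w\<bar> \<le> 2 * K" for i w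
      using s(3)[of w i] K[of w] g_eq[of w i] g_out[of w i] K0 by (cases "w \<in> space M") auto
    \<comment> \<open>\<open>D (e i)\<close> does not depend on \<open>i\<close>, since
      \<open>D (g i) = 0\<close>, and it tends to 0 by \<open>cont\<close> and dominated
      convergence.\<close>
    define e where "e i w = d w + (-1) * g i w" for i w
    have g_meas[measurable]: "g i \<in> borel_measurable M" for i using g_V[of i] by (simp add: V_def)
    have e_meas[measurable]: "e i \<in> borel_measurable M" for i by (simp add: e_def[abs_def])
    have e_le: "\<bar>e i w\<bar> \<le> 3 * K" for i w
      using K[of w] g_le[of i w] by (simp add: e_def)
    have "w \<in> space M \<Longrightarrow> (\<lambda>i. e i w) \<longlonglongrightarrow> 0" for w
      using tendsto_diff[OF tendsto_const[of "d w"] s(2)[of w]] by (simp add: e_def g_eq)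
    then have e_lim: "AE w in M. (\<lambda>i. e i w) \<longlonglongrightarrow> 0" by (rule AE_I2)
    have "(\<lambda>i. m (e i)) \<longlonglongrightarrow> 0" by (rule cont[OF e_meas e_le e_lim])
    moreover have "(\<lambda>i. \<integral>w. e i w * y w \<partial>M) \<longlonglongrightarrow> (\<integral>w. 0 \<partial>M)"
    proof (rule integral_dominated_convergence[where w = "\<lambda>w. 3 * K * y w"])
      show "AE w in M. (\<lambda>i. e i w * y w) \<longlonglongrightarrow> 0"
        using e_lim by eventually_elim (rule tendsto_mult_left_zero)
      show "AE w in M. norm (e i w * y w) \<le> 3 * K * y w" for i
        using e_le y0 by (intro AE_I2) (auto simp: abs_mult intro!: mult_right_mono)
    qed (use integrable_y in auto)
    ultimately have "(\<lambda>i. D (e i)) \<longlonglongrightarrow> 0 - (\<integral>w. 0 \<partial>M)" unfolding D_def by (rule tendsto_diff)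
    moreover have "D (e i) = D d" for i
    proof -
      have "(\<lambda>w. (-1) * g i w) \<in> V" using g_le[of i] by (intro VI[of _ "2 * K"]) auto
      then show ?thesis
        using D_add[OF d, of "\<lambda>w. (-1) * g i w"] D_cmult[OF g_V, of "-1" i] D_g[of i] by (simp add: e_def[abs_def])
    qed
    ultimately have "D d = 0" by (simp add: LIMSEQ_const_iff)
    then show ?thesis by (simp add: D_def)
  qed
  then show thesis using y0 integrable_y by (intro that[of y]) auto
qed

section \<open>Conditional expectations and weights\<close>

locale prob_subalgebra = prob_space M + finite_measure_subalgebra M F for M F :: "'a measure"
begin

lemma F_measurable: "f \<in> measurable F N \<Longrightarrow> f \<in> measurable M N"
  by (rule measurable_from_subalg[OF subalg])

lemma F_sets: "A \<in> sets F \<Longrightarrow> A \<in> sets M"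
  using subalg by (auto simp: subalgebra_def)

text \<open>The supremum of the conditional expectations has the right integral over every F-set, by
  monotone convergence on both sides. The conditional expectations increase only almost everywhere,
  hence the AE version on that side.\<close>

lemma nn_cond_exp_monotone_convergence:
  assumes [measurable]: "\<And>n::nat. f n \<in> borel_measurable M" and mono: "\<And>n w. f n w \<le> f (Suc n) w"
  shows "AE w in M. incseq (\<lambda>n. nn_cond_exp M F (f n) w) \<and>
    (SUP n. nn_cond_exp M F (f n) w) = nn_cond_exp M F (\<lambda>w. SUP n. f n w) w"
proof -
  have "AE w in M. nn_cond_exp M F (f n) w \<le> nn_cond_exp M F (f (Suc n)) w" for n
    by (rule nn_cond_exp_mono) (auto simp: mono)
  then have inc: "AE w in M. incseq (\<lambda>n. nn_cond_exp M F (f n) w)"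
    by (simp add: AE_all_countable incseq_Suc_iff)
  have "AE w in M. (SUP n. nn_cond_exp M F (f n) w) = nn_cond_exp M F (\<lambda>w. SUP n. f n w) w"
  proof (rule nn_cond_exp_charact)
    fix A assume A[measurable]: "A \<in> sets F"
    then have AM[measurable]: "A \<in> sets M" by (rule F_sets)
    have eq: "(\<integral>\<^sup>+ x \<in> A. nn_cond_exp M F (f n) x \<partial>M) = (\<integral>\<^sup>+ x \<in> A. f n x \<partial>M)" for n
      using nn_cond_exp_intg[of "indicator A" "f n"] by (simp add: mult.commute)
    have "(\<integral>\<^sup>+ x \<in> A. (SUP n. nn_cond_exp M F (f n) x) \<partial>M)
        = (\<integral>\<^sup>+ x. (SUP n. nn_cond_exp M F (f n) x * indicator A x) \<partial>M)"
      by (simp add: SUP_mult_right_ennreal)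
    also have "\<dots> = (SUP n. \<integral>\<^sup>+ x \<in> A. nn_cond_exp M F (f n) x \<partial>M)"
      using inc by (intro nn_integral_monotone_convergence_SUP_AE)
        (auto simp: incseq_Suc_iff intro!: mult_right_mono)
    also have "\<dots> = (SUP n. \<integral>\<^sup>+ x \<in> A. f n x \<partial>M)" by (simp add: eq)
    also have "\<dots> = (\<integral>\<^sup>+ x. (SUP n. f n x * indicator A x) \<partial>M)"
      by (rule nn_integral_monotone_convergence_SUP[symmetric])
        (auto simp: incseq_Suc_iff le_fun_def mono intro!: mult_right_mono)
    also have "\<dots> = (\<integral>\<^sup>+ x \<in> A. (SUP n. f n x) \<partial>M)"
      by (simp add: SUP_mult_right_ennreal)
    finally show "(\<integral>\<^sup>+ x \<in> A. (SUP n. f n x) \<partial>M) = (\<integral>\<^sup>+ x \<in> A. (SUP n. nn_cond_exp M F (f n) x) \<partial>M)" ..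
  qed auto
  with inc show ?thesis by eventually_elim auto
qed

section \<open>Extended conditional expectations as differences of nonnegative ones\<close>

lemma nn_cond_exp_zero: "AE w in M. nn_cond_exp M F (\<lambda>_. 0) w = 0"
  using nn_cond_exp_F_meas[OF borel_measurable_const, of 0] by eventually_elim auto

text \<open>Identifies each limit in the definition of \<open>ext_cond_exp\<close>. The coercion
  \<open>ennreal\<close> maps negative reals to 0, so \<open>ennreal (u w)\<close> is the positive
  part of \<open>u\<close>.\<close>

lemma lim_cond_exp_min:
  assumes [measurable]: "u \<in> borel_measurable M"
  shows "AE w in M. lim (\<lambda>n. ereal (real_cond_exp M F (\<lambda>w. min (max (u w) 0) (real n)) w))
    = enn2ereal (nn_cond_exp M F (\<lambda>w. ennreal (u w)) w)"
proof -
  define f where "f n w = ennreal (min (max (u w) 0) (real n))" for n w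
  have [measurable]: "f n \<in> borel_measurable M" for n by (simp add: f_def[abs_def])
  have real_eq: "AE w in M. ereal (real_cond_exp M F (\<lambda>w. min (max (u w) 0) (real n)) w)
      = enn2ereal (nn_cond_exp M F (f n) w)" for n
  proof -
    have neg: "(\<lambda>w. ennreal (- min (max (u w) 0) (real n))) = (\<lambda>_. 0)"
      by (intro ext ennreal_neg) auto
    \<comment> \<open>The bound by \<open>n\<close> makes the conditional expectation finite, so
      that \<open>enn2real\<close> inside \<open>real_cond_exp\<close> loses nothing.\<close>
    have "AE w in M. nn_cond_exp M F (f n) w \<le> nn_cond_exp M F (\<lambda>_. ennreal n) w"
      by (rule nn_cond_exp_mono) (auto simp: f_def)
    moreover have "AE w in M. ennreal n = nn_cond_exp M F (\<lambda>_. ennreal n) w"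
      by (rule nn_cond_exp_F_meas) auto
    ultimately show ?thesis using nn_cond_exp_zero
    proof eventually_elim
      case (elim w)
      then have "nn_cond_exp M F (f n) w < top" by (metis ennreal_less_top le_less_trans)
      then obtain c where "nn_cond_exp M F (f n) w = ennreal c" "c \<ge> 0"
        by (cases "nn_cond_exp M F (f n) w") auto
      then show ?case using elim
        by (simp add: real_cond_exp_def neg f_def[symmetric, abs_def] enn2ereal_ennreal)
    qed
  qed
  have "(SUP n. f n w) = ennreal (u w)" for w
  proof (rule antisym)
    show "(SUP n. f n w) \<le> ennreal (u w)"
    proof (rule SUP_least)
      fix n
      have "f n w \<le> ennreal (max (u w) 0)" unfolding f_def by (rule ennreal_leI) auto
      then show "f n w \<le> ennreal (u w)" by (simp add: ennreal_max_0')
    qed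
    obtain n where "u w \<le> real n" using real_arch_simple by blast
    then have "ennreal (u w) \<le> f n w" by (auto simp: f_def intro!: ennreal_leI)
    then show "ennreal (u w) \<le> (SUP n. f n w)" by (rule SUP_upper2[OF UNIV_I])
  qed
  then have "AE w in M. incseq (\<lambda>n. nn_cond_exp M F (f n) w) \<and>
      (SUP n. nn_cond_exp M F (f n) w) = nn_cond_exp M F (\<lambda>w. ennreal (u w)) w"
    using nn_cond_exp_monotone_convergence[of f] by (auto simp: f_def intro!: ennreal_leI)
  moreover have "AE w in M. \<forall>n. ereal (real_cond_exp M F (\<lambda>w. min (max (u w) 0) (real n)) w)
      = enn2ereal (nn_cond_exp M F (f n) w)"
    using real_eq by (simp add: AE_all_countable)
  ultimately show ?thesis
  proof eventually_elim
    case (elim w)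
    then have "(\<lambda>n. nn_cond_exp M F (f n) w) \<longlonglongrightarrow> nn_cond_exp M F (\<lambda>w. ennreal (u w)) w"
      using LIMSEQ_SUP by metis
    then have "(\<lambda>n. enn2ereal (nn_cond_exp M F (f n) w)) \<longlonglongrightarrow> enn2ereal (nn_cond_exp M F (\<lambda>w. ennreal (u w)) w)"
      by (rule tendsto_enn2erealI)
    then show ?case using elim by (simp add: limI)
  qed
qed

lemma ext_cond_exp_eq:
  assumes [measurable]: "u \<in> borel_measurable M"
  shows "AE w in M. ext_cond_exp M F u w =
    enn2ereal (nn_cond_exp M F (\<lambda>w. ennreal (u w)) w) - enn2ereal (nn_cond_exp M F (\<lambda>w. ennreal (- u w)) w)"
  using lim_cond_exp_min[of u] lim_cond_exp_min[of "\<lambda>w. - u w"]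
  by (auto simp: ext_cond_exp_def)

text \<open>F-measurability lets a weight pass through conditional expectations, strict positivity
  lets it be divided out, and the bound 1 puts a product of weights below each factor, so finitely
  many integrability conditions share one weight.\<close>

definition weights :: "('a \<Rightarrow> real) set" where
  "weights = {h \<in> borel_measurable F. \<forall>w. 0 < h w \<and> h w \<le> 1}"

lemma weightsD:
  assumes "h \<in> weights"
  shows "h \<in> borel_measurable F" "h \<in> borel_measurable M" "0 < h w" "h w \<le> 1" "0 \<le> h w"
  using assms by (auto simp: weights_def F_measurable intro: less_imp_le)

lemma weights_mult: "h \<in> weights \<Longrightarrow> k \<in> weights \<Longrightarrow> (\<lambda>w. h w * k w) \<in> weights"
  by (auto simp: weights_def intro: mult_le_one less_imp_le)

lemma weights_inverse:
  assumes [measurable]: "\<eta> \<in> borel_measurable F"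
  shows "(\<lambda>w. 1 / (1 + \<bar>\<eta> w\<bar>)) \<in> weights"
  by (auto simp: weights_def field_simps intro: add_pos_nonneg)

lemma weights_one: "(\<lambda>w. 1) \<in> weights"
  by (simp add: weights_def)

text \<open>Conditional integrability is integrability against an \<open>F\<close>-measurable weight; this
  replaces conditional expectations by ordinary integrals in most of what follows.\<close>

lemma nn_cond_exp_finite_iff:
  assumes [measurable]: "u \<in> borel_measurable M"
  shows "(AE w in M. nn_cond_exp M F u w < \<infinity>) \<longleftrightarrow> (\<exists>h\<in>weights. (\<integral>\<^sup>+ w. ennreal (h w) * u w \<partial>M) < \<infinity>)"
proof
  assume fin: "AE w in M. nn_cond_exp M F u w < \<infinity>"
  \<comment> \<open>Chosen so that h E[u|F] \<le> 1 wherever E[u|F] is finite.\<close>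
  define h where "h w = 1 / (1 + \<bar>enn2real (nn_cond_exp M F u w)\<bar>)" for w
  have h: "h \<in> weights" unfolding h_def by (rule weights_inverse) measurable
  note [measurable] = weightsD(1)[OF h]
  have "(\<integral>\<^sup>+ w. ennreal (h w) * u w \<partial>M) = (\<integral>\<^sup>+ w. ennreal (h w) * nn_cond_exp M F u w \<partial>M)"
    by (rule nn_cond_exp_intg[symmetric]) auto
  also have "\<dots> \<le> (\<integral>\<^sup>+ w. 1 \<partial>M)"
  proof (rule nn_integral_mono_AE, use fin in eventually_elim)
    case (elim w)
    then obtain c where c: "nn_cond_exp M F u w = ennreal c" "c \<ge> 0"
      by (cases "nn_cond_exp M F u w") auto
    then show ?case by (simp add: h_def flip: ennreal_mult)
  qed
  also have "\<dots> < \<infinity>" by (simp add: emeasure_space_1)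
  finally show "\<exists>h\<in>weights. (\<integral>\<^sup>+ w. ennreal (h w) * u w \<partial>M) < \<infinity>" using h by blast
next
  assume "\<exists>h\<in>weights. (\<integral>\<^sup>+ w. ennreal (h w) * u w \<partial>M) < \<infinity>"
  then obtain h where h: "h \<in> weights" and fin: "(\<integral>\<^sup>+ w. ennreal (h w) * u w \<partial>M) < \<infinity>" by blast
  note [measurable] = weightsD(1,2)[OF h]
  have "(\<integral>\<^sup>+ w. ennreal (h w) * nn_cond_exp M F u w \<partial>M) \<noteq> \<infinity>"
    using fin by (subst nn_cond_exp_intg) auto
  then have "AE w in M. ennreal (h w) * nn_cond_exp M F u w \<noteq> \<infinity>"
    by (intro nn_integral_noteq_infinite) auto
  then show "AE w in M. nn_cond_exp M F u w < \<infinity>"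
  proof eventually_elim
    case (elim w)
    then show ?case using weightsD(3)[OF h, of w] by (auto simp: less_top ennreal_mult_eq_top_iff)
  qed
qed

lemma L_cond_iff:
  assumes "r < \<infinity>"
  shows "x \<in> L_cond M F r \<longleftrightarrow> x \<in> borel_measurable M \<and>
    (\<exists>h\<in>weights. (\<integral>\<^sup>+ w. ennreal (h w * \<bar>x w\<bar> powr enn2real r) \<partial>M) < \<infinity>)"
proof (cases "x \<in> borel_measurable M")
  case [measurable]: True
  let ?u = "\<lambda>w. ennreal (\<bar>x w\<bar> powr enn2real r)"
  have "(AE w in M. ext_cond_exp M F (\<lambda>w. \<bar>x w\<bar> powr enn2real r) w < \<infinity>)
      \<longleftrightarrow> (AE w in M. nn_cond_exp M F ?u w < \<infinity>)"
  proof (rule eventually_cong)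
    have "AE w in M. ext_cond_exp M F (\<lambda>w. \<bar>x w\<bar> powr enn2real r) w
        = enn2ereal (nn_cond_exp M F ?u w) - enn2ereal (nn_cond_exp M F (\<lambda>w. 0) w)"
      using ext_cond_exp_eq[of "\<lambda>w. \<bar>x w\<bar> powr enn2real r"] by (simp add: ennreal_neg)
    then show "AE w in M. ext_cond_exp M F (\<lambda>w. \<bar>x w\<bar> powr enn2real r) w = enn2ereal (nn_cond_exp M F ?u w)"
      using nn_cond_exp_zero by eventually_elim (auto simp: zero_ennreal.rep_eq)
  next
    show "ext_cond_exp M F (\<lambda>w. \<bar>x w\<bar> powr enn2real r) w = enn2ereal (nn_cond_exp M F ?u w) \<Longrightarrow>
      (ext_cond_exp M F (\<lambda>w. \<bar>x w\<bar> powr enn2real r) w < \<infinity>) = (nn_cond_exp M F ?u w < \<infinity>)" for w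
      by (simp add: less_ennreal.rep_eq)
  qed
  also have "\<dots> \<longleftrightarrow> (\<exists>h\<in>weights. (\<integral>\<^sup>+ w. ennreal (h w) * ?u w \<partial>M) < \<infinity>)"
    by (rule nn_cond_exp_finite_iff) measurable
  also have "\<dots> \<longleftrightarrow> (\<exists>h\<in>weights. (\<integral>\<^sup>+ w. ennreal (h w * \<bar>x w\<bar> powr enn2real r) \<partial>M) < \<infinity>)"
    by (intro bex_cong refl) (simp add: ennreal_mult weightsD)
  finally show ?thesis using assms True by (simp add: L_cond_def less_imp_neq)
next
  case False
  then show ?thesis using assms by (auto simp: L_cond_def)
qed

lemma L_cond_1_iff:
  "x \<in> L_cond M F 1 \<longleftrightarrow> x \<in> borel_measurable M \<and> (\<exists>h\<in>weights. integrable M (\<lambda>w. h w * x w))"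
proof (cases "x \<in> borel_measurable M")
  case [measurable]: True
  have "(\<integral>\<^sup>+ w. ennreal (h w * \<bar>x w\<bar>) \<partial>M) < \<infinity> \<longleftrightarrow> integrable M (\<lambda>w. h w * x w)" if h: "h \<in> weights" for h
  proof -
    note [measurable] = weightsD(1,2)[OF h]
    show ?thesis using weightsD(5)[OF h] by (simp add: integrable_iff_bounded abs_mult)
  qed
  then show ?thesis using L_cond_iff[of 1] by auto
qed (auto simp: L_cond_iff)

text \<open>E[h v|F] = h E[v|F] holds for nonnegative functions, so it is applied to the positive
  and the negative part of \<open>u\<close> separately. Integrability of h u makes both parts
  finite, and the difference is then an ordinary real number.\<close>

lemma ext_cond_exp_weighted:
  assumes h: "h \<in> weights" and [measurable]: "u \<in> borel_measurable M"
    and int: "integrable M (\<lambda>w. h w * u w)"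
  shows "AE w in M. ext_cond_exp M F u w = ereal (real_cond_exp M F (\<lambda>w. h w * u w) w / h w)"
proof -
  note [measurable] = weightsD(1,2)[OF h]
  have part: "AE w in M. nn_cond_exp M F (\<lambda>w. ennreal (h w * v w)) w = ennreal (h w) * nn_cond_exp M F (\<lambda>w. ennreal (v w)) w
      \<and> nn_cond_exp M F (\<lambda>w. ennreal (v w)) w < \<infinity>"
    if [measurable]: "v \<in> borel_measurable M" and v: "integrable M (\<lambda>w. h w * v w)" for v
  proof -
    have "AE w in M. ennreal (h w) * nn_cond_exp M F (\<lambda>w. ennreal (v w)) w
        = nn_cond_exp M F (\<lambda>w. ennreal (h w) * ennreal (v w)) w"
      by (rule nn_cond_exp_prod) auto
    moreover have "(\<lambda>w. ennreal (h w) * ennreal (v w)) = (\<lambda>w. ennreal (h w * v w))"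
      using weightsD(5)[OF h] by (auto simp: ennreal_mult' intro!: ext)
    moreover have "(\<integral>\<^sup>+ w. ennreal (h w * v w) \<partial>M) < \<infinity>"
      using v by (auto simp: real_integrable_def less_top)
    ultimately show ?thesis
      using nn_cond_exp_finite_iff[of "\<lambda>w. ennreal (v w)"] h by (auto elim!: eventually_mono dest!: bspec)
  qed
  have "integrable M (\<lambda>w. h w * - u w)" using int by simp
  then have "AE w in M. nn_cond_exp M F (\<lambda>w. ennreal (h w * - u w)) w = ennreal (h w) * nn_cond_exp M F (\<lambda>w. ennreal (- u w)) w
      \<and> nn_cond_exp M F (\<lambda>w. ennreal (- u w)) w < \<infinity>"
    by (intro part) auto
  then show ?thesis using part[OF assms(2) int] ext_cond_exp_eq[OF assms(2)]
  proof eventually_elim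
    case (elim w)
    obtain a where a: "nn_cond_exp M F (\<lambda>w. ennreal (u w)) w = ennreal a" "a \<ge> 0"
      using elim by (cases "nn_cond_exp M F (\<lambda>w. ennreal (u w)) w") auto
    obtain b where b: "nn_cond_exp M F (\<lambda>w. ennreal (- u w)) w = ennreal b" "b \<ge> 0"
      using elim by (cases "nn_cond_exp M F (\<lambda>w. ennreal (- u w)) w") auto
    show ?case using elim a b weightsD(3,5)[OF h, of w]
      by (simp add: real_cond_exp_def enn2real_mult field_simps)
  qed
qed

end

section \<open>Conditional Lebesgue spaces\<close>

locale cond_Lp = prob_subalgebra +
  fixes p :: ennreal
  assumes p_ge_1: "1 \<le> p" and p_finite: "p < \<infinity>"
begin

abbreviation X :: "('a \<Rightarrow> real) set" where "X \<equiv> L_cond M F p"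
abbreviation r :: real where "r \<equiv> enn2real p"

lemma r_ge_1: "1 \<le> r"
  using p_ge_1 p_finite by (cases p) auto

lemmas X_iff = L_cond_iff[OF p_finite]

lemma X_measurable: "x \<in> X \<Longrightarrow> x \<in> borel_measurable M"
  by (simp add: X_iff)

lemma X_solid:
  assumes x: "x \<in> X" and [measurable]: "z \<in> borel_measurable M" and le: "AE w in M. \<bar>z w\<bar> \<le> \<bar>x w\<bar>"
  shows "z \<in> X"
proof -
  obtain h where h: "h \<in> weights" and fin: "(\<integral>\<^sup>+ w. ennreal (h w * \<bar>x w\<bar> powr r) \<partial>M) < \<infinity>"
    using x by (auto simp: X_iff)
  have "(\<integral>\<^sup>+ w. ennreal (h w * \<bar>z w\<bar> powr r) \<partial>M) \<le> (\<integral>\<^sup>+ w. ennreal (h w * \<bar>x w\<bar> powr r) \<partial>M)"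
    using le r_ge_1 weightsD(5)[OF h]
    by (intro nn_integral_mono_AE) (auto elim!: eventually_mono intro!: ennreal_leI mult_left_mono powr_mono2)
  with fin have "(\<integral>\<^sup>+ w. ennreal (h w * \<bar>z w\<bar> powr r) \<partial>M) < \<infinity>" by (rule le_less_trans[rotated])
  then show ?thesis using h by (auto simp: X_iff)
qed

text \<open>If h serves x and k serves z, then h k serves the sum, by |x + z|^r \<le> 2^r (|x|^r +
  |z|^r).\<close>

lemma X_add:
  assumes "x \<in> X" "z \<in> X"
  shows "(\<lambda>w. x w + z w) \<in> X"
proof -
  note [measurable] = assms[THEN X_measurable]
  obtain h where h: "h \<in> weights" and fin: "(\<integral>\<^sup>+ w. ennreal (h w * \<bar>x w\<bar> powr r) \<partial>M) < \<infinity>"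
    using assms by (auto simp: X_iff)
  obtain k where k: "k \<in> weights" and fin': "(\<integral>\<^sup>+ w. ennreal (k w * \<bar>z w\<bar> powr r) \<partial>M) < \<infinity>"
    using assms by (auto simp: X_iff)
  note [measurable] = weightsD(1,2)[OF h] weightsD(1,2)[OF k]
  have le: "h w * k w * \<bar>x w + z w\<bar> powr r
      \<le> 2 powr r * (h w * \<bar>x w\<bar> powr r) + 2 powr r * (k w * \<bar>z w\<bar> powr r)" for w
  proof -
    have "\<bar>x w + z w\<bar> powr r \<le> (2 * max \<bar>x w\<bar> \<bar>z w\<bar>) powr r"
      using r_ge_1 by (intro powr_mono2) auto
    also have "\<dots> = 2 powr r * max \<bar>x w\<bar> \<bar>z w\<bar> powr r" by (simp add: powr_mult)
    also have "max \<bar>x w\<bar> \<bar>z w\<bar> powr r \<le> \<bar>x w\<bar> powr r + \<bar>z w\<bar> powr r" by (auto simp: max_def)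
    finally have "\<bar>x w + z w\<bar> powr r \<le> 2 powr r * \<bar>x w\<bar> powr r + 2 powr r * \<bar>z w\<bar> powr r"
      by (simp add: algebra_simps)
    then have "h w * k w * \<bar>x w + z w\<bar> powr r
        \<le> h w * k w * (2 powr r * \<bar>x w\<bar> powr r + 2 powr r * \<bar>z w\<bar> powr r)"
      using weightsD(5)[OF h, of w] weightsD(5)[OF k, of w] by (intro mult_left_mono) auto
    also have "\<dots> = (h w * k w) * (2 powr r * \<bar>x w\<bar> powr r) + (h w * k w) * (2 powr r * \<bar>z w\<bar> powr r)"
      by (rule distrib_left)
    also have "\<dots> \<le> h w * (2 powr r * \<bar>x w\<bar> powr r) + k w * (2 powr r * \<bar>z w\<bar> powr r)"
      using weightsD(3-5)[OF h, of w] weightsD(3-5)[OF k, of w]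
      by (intro add_mono mult_right_mono) (auto intro: mult_left_le mult_left_le_one_le)
    finally show ?thesis by (simp add: algebra_simps)
  qed
  have "(\<integral>\<^sup>+ w. ennreal (h w * k w * \<bar>x w + z w\<bar> powr r) \<partial>M)
      \<le> (\<integral>\<^sup>+ w. ennreal (2 powr r * (h w * \<bar>x w\<bar> powr r)) + ennreal (2 powr r * (k w * \<bar>z w\<bar> powr r)) \<partial>M)"
    using le weightsD(5)[OF h] weightsD(5)[OF k]
    by (intro nn_integral_mono) (simp add: ennreal_leI flip: ennreal_plus)
  also have "\<dots> = (\<integral>\<^sup>+ w. ennreal (2 powr r) * ennreal (h w * \<bar>x w\<bar> powr r) \<partial>M)
      + (\<integral>\<^sup>+ w. ennreal (2 powr r) * ennreal (k w * \<bar>z w\<bar> powr r) \<partial>M)"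
    by (subst nn_integral_add) (auto simp: ennreal_mult')
  also have "\<dots> < \<infinity>"
    using fin fin' by (simp add: nn_integral_cmult ennreal_mult_less_top)
  finally have "(\<integral>\<^sup>+ w. ennreal (h w * k w * \<bar>x w + z w\<bar> powr r) \<partial>M) < \<infinity>" .
  then show ?thesis using weights_mult[OF h k] by (auto simp: X_iff intro!: bexI[of _ "\<lambda>w. h w * k w"])
qed

lemma X_scale:
  assumes [measurable]: "\<eta> \<in> borel_measurable F" and x: "x \<in> X"
  shows "(\<lambda>w. \<eta> w * x w) \<in> X"
proof -
  note [measurable] = X_measurable[OF x] F_measurable[OF assms(1)]
  obtain h where h: "h \<in> weights" and fin: "(\<integral>\<^sup>+ w. ennreal (h w * \<bar>x w\<bar> powr r) \<partial>M) < \<infinity>"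
    using x by (auto simp: X_iff)
  \<comment> \<open>This extra weight absorbs the factor |\<eta>|^r. The outer absolute value only
    matches the form of \<open>weights_inverse\<close>.\<close>
  define k where "k w = 1 / (1 + \<bar>\<bar>\<eta> w\<bar> powr r\<bar>)" for w
  have k: "k \<in> weights" unfolding k_def by (rule weights_inverse) measurable
  have "(\<integral>\<^sup>+ w. ennreal (h w * k w * \<bar>\<eta> w * x w\<bar> powr r) \<partial>M) \<le> (\<integral>\<^sup>+ w. ennreal (h w * \<bar>x w\<bar> powr r) \<partial>M)"
  proof (intro nn_integral_mono ennreal_leI)
    fix w
    have "k w * \<bar>\<eta> w\<bar> powr r \<le> 1" by (simp add: k_def divide_le_eq add_pos_nonneg)
    then have "(k w * \<bar>\<eta> w\<bar> powr r) * (h w * \<bar>x w\<bar> powr r) \<le> 1 * (h w * \<bar>x w\<bar> powr r)"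
      using weightsD(5)[OF h] by (intro mult_right_mono) auto
    then show "h w * k w * \<bar>\<eta> w * x w\<bar> powr r \<le> h w * \<bar>x w\<bar> powr r"
      by (simp add: abs_mult powr_mult algebra_simps)
  qed
  with fin have "(\<integral>\<^sup>+ w. ennreal (h w * k w * \<bar>\<eta> w * x w\<bar> powr r) \<partial>M) < \<infinity>" by (rule le_less_trans[rotated])
  then show ?thesis using weights_mult[OF h k] by (auto simp: X_iff intro!: bexI[of _ "\<lambda>w. h w * k w"])
qed

lemma X_const: "(\<lambda>w. c) \<in> X"
  using weights_one by (auto simp: X_iff intro!: bexI[of _ "\<lambda>w. 1"] simp: emeasure_space_1 less_top)

lemma X_cmult: "x \<in> X \<Longrightarrow> (\<lambda>w. c * x w) \<in> X"
  by (rule X_scale) auto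

lemma X_diff: "x \<in> X \<Longrightarrow> z \<in> X \<Longrightarrow> (\<lambda>w. x w - z w) \<in> X"
  using X_add[OF _ X_cmult[of z "-1"]] by simp

lemma X_abs: "x \<in> X \<Longrightarrow> (\<lambda>w. \<bar>x w\<bar>) \<in> X"
  by (rule X_solid[of x]) (auto intro: X_measurable borel_measurable_abs)

lemma X_bounded: "x \<in> borel_measurable M \<Longrightarrow> (\<And>w. \<bar>x w\<bar> \<le> c) \<Longrightarrow> x \<in> X"
  by (rule X_solid[OF X_const[of c]]) (auto intro: order_trans[OF _ abs_ge_self])

text \<open>W is the pointwise l^r norm of the sequence, so its weighted r-th moment is the sum of
  those of the v k. Both constructions that need one element of \<open>X\<close> above a whole
  sequence use it.\<close>

lemma X_majorant:
  assumes h: "h \<in> weights" and [measurable]: "\<And>k::nat. v k \<in> borel_measurable M"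
    and v_nonneg: "\<And>k w. 0 \<le> v k w"
    and fin: "(\<Sum>k. \<integral>\<^sup>+ w. ennreal (h w * v k w powr r) \<partial>M) < \<infinity>"
  obtains W where "W \<in> X" "\<And>w. 0 \<le> W w" "AE w in M. \<forall>k. v k w \<le> W w"
proof -
  note [measurable] = weightsD(2)[OF h]
  define U where "U w = (\<Sum>k. ennreal (v k w powr r))" for w
  have [measurable]: "U \<in> borel_measurable M" by (simp add: U_def[abs_def])
  \<comment> \<open>\<open>enn2real\<close> turns an infinite sum into 0. This keeps
    \<open>W\<close> real-valued and loses the domination only on a null set.\<close>
  define W where "W w = enn2real (U w) powr (1 / r)" for w
  have W_powr: "W w powr r = enn2real (U w)" for w
    using r_ge_1 by (simp add: W_def powr_powr)
  have "(\<integral>\<^sup>+ w. ennreal (h w) * U w \<partial>M) = (\<integral>\<^sup>+ w. (\<Sum>k. ennreal (h w * v k w powr r)) \<partial>M)"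
    using weightsD(5)[OF h] by (simp add: U_def ennreal_mult)
  also have "\<dots> = (\<Sum>k. \<integral>\<^sup>+ w. ennreal (h w * v k w powr r) \<partial>M)"
    by (rule nn_integral_suminf) measurable
  finally have hU: "(\<integral>\<^sup>+ w. ennreal (h w) * U w \<partial>M) < \<infinity>" using fin by simp
  then have "AE w in M. ennreal (h w) * U w \<noteq> \<infinity>"
    by (intro nn_integral_noteq_infinite) auto
  then have U_fin: "AE w in M. U w < \<infinity>"
  proof eventually_elim
    case (elim w)
    then show ?case using weightsD(3)[OF h, of w] by (auto simp: less_top ennreal_mult_eq_top_iff)
  qed
  have "(\<integral>\<^sup>+ w. ennreal (h w * \<bar>W w\<bar> powr r) \<partial>M) \<le> (\<integral>\<^sup>+ w. ennreal (h w) * U w \<partial>M)"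
  proof (rule nn_integral_mono)
    fix w
    have "ennreal (h w * \<bar>W w\<bar> powr r) = ennreal (h w) * ennreal (enn2real (U w))"
      using weightsD(5)[OF h] W_powr by (simp add: ennreal_mult W_def)
    also have "\<dots> \<le> ennreal (h w) * U w"
      by (intro mult_left_mono) (simp_all add: ennreal_enn2real_if)
    finally show "ennreal (h w * \<bar>W w\<bar> powr r) \<le> ennreal (h w) * U w" .
  qed
  then have "(\<integral>\<^sup>+ w. ennreal (h w * \<bar>W w\<bar> powr r) \<partial>M) < \<infinity>" using hU by (rule le_less_trans)
  moreover have "W \<in> borel_measurable M" unfolding W_def[abs_def] by measurable
  ultimately have WX: "W \<in> X" unfolding X_iff by (intro conjI bexI[OF _ h])
  have "AE w in M. \<forall>k. v k w \<le> W w"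
    using U_fin
  proof eventually_elim
    case (elim w)
    show ?case
    proof
      fix k
      have "(\<Sum>i\<in>{k}. ennreal (v i w powr r)) \<le> U w"
        unfolding U_def by (rule sum_le_suminf[OF summableI]) auto
      then have "ennreal (v k w powr r) \<le> U w" by simp
      then have "v k w powr r \<le> W w powr r"
        unfolding W_powr using elim by (cases "U w") auto
      moreover have "0 \<le> W w" by (simp add: W_def)
      ultimately show "v k w \<le> W w"
        using r_ge_1 powr_less_mono2[of r "W w" "v k w"] by linarith
    qed
  qed
  with WX show thesis by (intro that[of W]) (auto simp: W_def)
qed

end

section \<open>The Koethe dual\<close>

context cond_Lp begin

text \<open>A gliding hump: the test functions \<open>u k\<close> are assembled into a single element \<open>W \<ge> 2\<^sup>-\<^sup>k u k\<close> of \<open>X\<close>.\<close>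

lemma kothe_gliding_hump:
  assumes y: "y \<in> kothe_dual M F X"
    and [measurable]: "\<And>k::nat. u k \<in> borel_measurable M" and u0: "\<And>k w. 0 \<le> u k w"
    and u_norm: "\<And>k. (\<integral>\<^sup>+ w. ennreal (u k w powr r) \<partial>M) \<le> 1"
    and A: "\<And>k. A k \<in> sets F" and B: "B \<in> sets F"
    and AB: "\<And>k. emeasure M (B - A k) \<le> ennreal ((1/2)^k)"
    and big: "\<And>k h. h \<in> weights \<Longrightarrow>
      ennreal (4^k) * (\<integral>\<^sup>+ w. ennreal (h w) * indicator (A k) w \<partial>M) \<le> (\<integral>\<^sup>+ w. ennreal (h w * (u k w * \<bar>y w\<bar>)) \<partial>M)"
  shows "B \<in> null_sets M"
proof -
  have [measurable]: "y \<in> borel_measurable M" using y by (simp add: kothe_dual_def)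
  have [measurable]: "A k \<in> sets M" "B \<in> sets M" for k using A B F_sets by auto
  \<comment> \<open>The factor 2^-k makes the r-th moments summable, since (2^-k)^r \<le> 2^-k for r
    \<ge> 1.\<close>
  define v where "v k w = (1/2)^k * u k w" for k :: nat and w
  have v_meas[measurable]: "v k \<in> borel_measurable M" for k by (simp add: v_def[abs_def])
  have v0: "0 \<le> v k w" for k w using u0 by (simp add: v_def)
  have v_int: "(\<integral>\<^sup>+ w. ennreal (1 * v k w powr r) \<partial>M) \<le> ennreal ((1/2)^k)" for k
  proof -
    have "((1/2)^k) powr r \<le> ((1/2)^k) powr 1"
      using r_ge_1 by (intro powr_mono') (auto simp: power_le_one)
    then have c: "((1/2)^k) powr r \<le> (1/2)^k" by simp
    have "(\<integral>\<^sup>+ w. ennreal (1 * v k w powr r) \<partial>M) = (\<integral>\<^sup>+ w. ennreal (((1/2)^k) powr r) * ennreal (u k w powr r) \<partial>M)"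
      using u0 by (intro nn_integral_cong) (simp add: v_def powr_mult flip: ennreal_mult)
    also have "\<dots> = ennreal (((1/2)^k) powr r) * (\<integral>\<^sup>+ w. ennreal (u k w powr r) \<partial>M)"
      by (rule nn_integral_cmult) measurable
    also have "\<dots> \<le> ennreal ((1/2)^k) * 1"
      using c u_norm by (intro mult_mono ennreal_leI) auto
    finally show ?thesis by simp
  qed
  have "(\<Sum>k. \<integral>\<^sup>+ w. ennreal (1 * v k w powr r) \<partial>M) \<le> (\<Sum>k. ennreal ((1/2)^k))"
    by (intro suminf_le v_int) auto
  also have "\<dots> = ennreal (\<Sum>k. (1/2)^k)"
    by (rule suminf_ennreal_eq) (auto intro!: summable_sums simp: summable_geometric)
  finally have "(\<Sum>k. \<integral>\<^sup>+ w. ennreal (1 * v k w powr r) \<partial>M) < \<infinity>"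
    by (rule le_less_trans) simp
  then obtain W where W: "W \<in> X" "\<And>w. 0 \<le> W w" "AE w in M. \<forall>k. v k w \<le> W w"
    using X_majorant[OF weights_one, of v, OF v_meas v0] by blast
  note [measurable] = X_measurable[OF W(1)]
  obtain h where h: "h \<in> weights" and int: "integrable M (\<lambda>w. h w * (W w * y w))"
    using y W(1) by (auto simp: kothe_dual_def L_cond_1_iff)
  note [measurable] = weightsD(2)[OF h]
  define C where "C = (\<integral>\<^sup>+ w. ennreal (h w * (W w * \<bar>y w\<bar>)) \<partial>M)"
  have "C = (\<integral>\<^sup>+ w. ennreal (norm (h w * (W w * y w))) \<partial>M)"
    using W(2) weightsD(5)[OF h] by (simp add: C_def abs_mult)
  then have C_fin: "C < \<infinity>" using int by (simp add: integrable_iff_bounded)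
  \<comment> \<open>\<open>big\<close> gains 4^k, while passing from \<open>u k\<close> to
    \<open>W\<close> costs only 2^k. So the h-mass of \<open>A k\<close> is at most 2^-k C, and the
    rest of \<open>B\<close> has measure at most 2^-k. As k grows, the h-mass of \<open>B\<close>
    vanishes, and h > 0.\<close>
  have bound: "(\<integral>\<^sup>+ w. ennreal (h w) * indicator B w \<partial>M) \<le> ennreal ((1/2)^k) * (C + 1)" for k
  proof -
    define a where "a = (\<integral>\<^sup>+ w. ennreal (h w) * indicator (A k) w \<partial>M)"
    have "ennreal (4^k) * a \<le> (\<integral>\<^sup>+ w. ennreal (h w * (u k w * \<bar>y w\<bar>)) \<partial>M)"
      unfolding a_def by (rule big[OF h])
    also have "\<dots> \<le> (\<integral>\<^sup>+ w. ennreal (2^k) * ennreal (h w * (W w * \<bar>y w\<bar>)) \<partial>M)"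
    proof (rule nn_integral_mono_AE, use W(3) in eventually_elim)
      case (elim w)
      have "u k w \<le> 2^k * W w" using elim[rule_format, of k] by (simp add: v_def field_simps)
      then have "h w * (u k w * \<bar>y w\<bar>) \<le> h w * (2^k * W w * \<bar>y w\<bar>)"
        using weightsD(5)[OF h] by (intro mult_left_mono mult_right_mono) auto
      then show ?case using weightsD(5)[OF h, of w] W(2)[of w]
        by (simp add: ennreal_leI mult_ac flip: ennreal_mult)
    qed
    also have "\<dots> = ennreal (2^k) * C" unfolding C_def by (rule nn_integral_cmult) measurable
    finally have "ennreal ((1/4)^k) * (ennreal (4^k) * a) \<le> ennreal ((1/4)^k) * (ennreal (2^k) * C)"
      by (rule mult_left_mono) simp
    moreover have "ennreal ((1/4)^k) * ennreal (4^k) = 1"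
      by (simp flip: ennreal_mult power_mult_distrib)
    moreover have "ennreal ((1/4)^k) * ennreal (2^k) = ennreal ((1/2)^k)"
      by (simp flip: ennreal_mult power_mult_distrib)
    ultimately have a_le: "a \<le> ennreal ((1/2)^k) * C" by (simp flip: mult.assoc)
    have "(\<integral>\<^sup>+ w. ennreal (h w) * indicator B w \<partial>M)
        \<le> (\<integral>\<^sup>+ w. ennreal (h w) * indicator (A k) w + indicator (B - A k) w \<partial>M)"
      using weightsD(4)[OF h] by (intro nn_integral_mono) (auto split: split_indicator)
    also have "\<dots> = a + emeasure M (B - A k)"
      unfolding a_def by (subst nn_integral_add) auto
    also have "\<dots> \<le> ennreal ((1/2)^k) * C + ennreal ((1/2)^k)" by (intro add_mono a_le AB)
    finally show ?thesis by (simp add: distrib_left)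
  qed
  obtain c where c: "C = ennreal c" "c \<ge> 0" using C_fin by (cases C) auto
  have "(\<lambda>k. ennreal ((1/2)^k * (c + 1))) \<longlonglongrightarrow> ennreal (0 * (c + 1))"
    by (intro tendsto_ennrealI tendsto_intros LIMSEQ_power_zero) auto
  moreover have "(\<integral>\<^sup>+ w. ennreal (h w) * indicator B w \<partial>M) \<le> ennreal ((1/2)^k * (c + 1))" for k
    using bound[of k] c by (simp add: ennreal_mult' flip: ennreal_plus ennreal_1)
  ultimately have "(\<integral>\<^sup>+ w. ennreal (h w) * indicator B w \<partial>M) \<le> ennreal (0 * (c + 1))"
    by (intro LIMSEQ_le_const) auto
  then have "(\<integral>\<^sup>+ w. ennreal (h w) * indicator B w \<partial>M) = 0" by simp
  then have "AE w in M. ennreal (h w) * indicator B w = 0"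
    by (subst (asm) nn_integral_0_iff_AE) auto
  then have "AE w in M. w \<notin> B"
  proof eventually_elim
    case (elim w)
    have "ennreal (h w) \<noteq> 0" using weightsD(3)[OF h, of w] by (simp add: ennreal_eq_0_iff not_le)
    then show ?case using elim by auto
  qed
  then show ?thesis using AE_iff_null_sets[of B M] by simp
qed

text \<open>\<open>T k\<close> is the conditional probability of {|y| > 4^k}. Where some
  \<open>T k\<close> vanishes, |y| \<le> 4^k; \<open>B\<close> is the set where none does. The test
  function 1_B 1_{D k} / T k has conditional mean 1_B and is supported where |y| > 4^k, so the
  gliding hump shows that \<open>B\<close> is null.\<close>

lemma kothe_dual_subset_infinity:
  assumes r1: "r = 1" and y: "y \<in> kothe_dual M F X"
  shows "y \<in> L_cond M F \<infinity>"
proof -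
  have [measurable]: "y \<in> borel_measurable M" using y by (simp add: kothe_dual_def)
  define D where "D k = {w \<in> space M. 4^k < \<bar>y w\<bar>}" for k :: nat
  have [measurable]: "D k \<in> sets M" for k by (simp add: D_def)
  define T where "T k = nn_cond_exp M F (indicator (D k))" for k
  have T_meas[measurable]: "T k \<in> borel_measurable F" for k by (simp add: T_def)
  note [measurable] = F_measurable[OF T_meas]
  have T_int: "(\<integral>\<^sup>+ w. g w * T k w \<partial>M) = (\<integral>\<^sup>+ w. g w * indicator (D k) w \<partial>M)" if "g \<in> borel_measurable F" for g k
    unfolding T_def using that by (intro nn_cond_exp_intg) auto
  have "AE w in M. T k w \<le> nn_cond_exp M F (\<lambda>w. 1) w" for k
    unfolding T_def by (rule nn_cond_exp_mono) (auto split: split_indicator)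
  moreover have "AE w in M. 1 = nn_cond_exp M F (\<lambda>w. 1) w" by (rule nn_cond_exp_F_meas) auto
  ultimately have T_le: "AE w in M. T k w \<le> 1" for k by fastforce
  define B where "B = {w \<in> space F. \<forall>k. T k w \<noteq> 0}"
  have BF[measurable]: "B \<in> sets F" by (simp add: B_def)
  define u where "u k w = indicator B w * indicator (D k) w * (1 / enn2real (T k w))" for k w
  have "B \<in> null_sets M"
  proof (rule kothe_gliding_hump[OF y, where u = u and A = "\<lambda>k. B"])
    have [measurable]: "B \<in> sets M" by (rule F_sets[OF BF])
    show "u k \<in> borel_measurable M" for k unfolding u_def[abs_def] by measurable
    show "0 \<le> u k w" for k w by (simp add: u_def)
    have inv: "AE w in M. indicator B w * ennreal (1 / enn2real (T k w)) * T k w = indicator B w" for k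
      using T_le[of k]
    proof eventually_elim
      case (elim w)
      then obtain c where c: "T k w = ennreal c" "0 \<le> c"
        by (cases "T k w") (auto simp: top_unique)
      have "c \<noteq> 0" if "w \<in> B" using that c by (auto simp: B_def)
      then show ?case using c by (auto split: split_indicator simp flip: ennreal_mult)
    qed
    have u_int: "(\<integral>\<^sup>+ w. ennreal (h w) * ennreal (u k w) \<partial>M) = (\<integral>\<^sup>+ w. ennreal (h w) * indicator B w \<partial>M)"
      if h: "h \<in> weights" for h k
    proof -
      note [measurable] = weightsD(1)[OF h]
      have "(\<integral>\<^sup>+ w. ennreal (h w) * ennreal (u k w) \<partial>M)
          = (\<integral>\<^sup>+ w. (ennreal (h w) * (indicator B w * ennreal (1 / enn2real (T k w)))) * indicator (D k) w \<partial>M)"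
        by (intro nn_integral_cong) (auto simp: u_def split: split_indicator)
      also have "\<dots> = (\<integral>\<^sup>+ w. (ennreal (h w) * (indicator B w * ennreal (1 / enn2real (T k w)))) * T k w \<partial>M)"
        by (rule T_int[symmetric]) measurable
      also have "\<dots> = (\<integral>\<^sup>+ w. ennreal (h w) * indicator B w \<partial>M)"
        using inv[of k] by (intro nn_integral_cong_AE) (auto elim!: eventually_mono simp: mult.assoc)
      finally show ?thesis .
    qed
    show "(\<integral>\<^sup>+ w. ennreal (u k w powr r) \<partial>M) \<le> 1" for k
    proof -
      have "(\<integral>\<^sup>+ w. ennreal (u k w powr r) \<partial>M) = (\<integral>\<^sup>+ w. ennreal 1 * ennreal (u k w) \<partial>M)"
        by (intro nn_integral_cong) (simp add: r1 u_def)
      also have "\<dots> = emeasure M B" using u_int[OF weights_one, of k] by simp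
      finally show ?thesis using emeasure_le_1 by simp
    qed
    fix k h assume h: "h \<in> weights"
    note [measurable] = weightsD(2)[OF h]
    have "ennreal (4^k) * (\<integral>\<^sup>+ w. ennreal (h w) * indicator B w \<partial>M) = ennreal (4^k) * (\<integral>\<^sup>+ w. ennreal (h w) * ennreal (u k w) \<partial>M)"
      using u_int[OF h] by simp
    also have "\<dots> = (\<integral>\<^sup>+ w. ennreal (4^k) * (ennreal (h w) * ennreal (u k w)) \<partial>M)"
      by (rule nn_integral_cmult[symmetric]) (simp add: u_def[abs_def])
    also have "\<dots> \<le> (\<integral>\<^sup>+ w. ennreal (h w * (u k w * \<bar>y w\<bar>)) \<partial>M)"
    proof (rule nn_integral_mono)
      fix w
      have "u k w * 4^k \<le> u k w * \<bar>y w\<bar>"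
        by (auto simp: u_def D_def intro!: divide_right_mono split: split_indicator)
      then have "h w * (u k w * 4^k) \<le> h w * (u k w * \<bar>y w\<bar>)"
        using weightsD(5)[OF h] by (rule mult_left_mono)
      moreover have "0 \<le> u k w" by (simp add: u_def)
      ultimately show "ennreal (4^k) * (ennreal (h w) * ennreal (u k w)) \<le> ennreal (h w * (u k w * \<bar>y w\<bar>))"
        using weightsD(5)[OF h, of w] by (simp add: ennreal_leI mult_ac flip: ennreal_mult)
    qed
    finally show "ennreal (4^k) * (\<integral>\<^sup>+ w. ennreal (h w) * indicator B w \<partial>M) \<le> (\<integral>\<^sup>+ w. ennreal (h w * (u k w * \<bar>y w\<bar>)) \<partial>M)" .
  qed auto
  then have nB: "AE w in M. w \<notin> B" by (rule AE_not_in)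
  \<comment> \<open>The first threshold whose conditional exceedance probability is 0. It exists off
    \<open>B\<close>, and minimality over the naturals keeps the choice F-measurable.\<close>
  define \<eta> where "\<eta> w = (4 :: real) ^ (LEAST k. T k w = 0)" for w
  have \<eta>_meas: "\<eta> \<in> borel_measurable F"
  proof -
    have "(\<lambda>w. LEAST k. T k w = 0) \<in> measurable F (count_space UNIV)"
      by (rule measurable_Least) measurable
    then show ?thesis unfolding \<eta>_def by measurable
  qed
  have "AE w in M. T k w = 0 \<longrightarrow> \<bar>y w\<bar> \<le> 4^k" for k
  proof -
    have "(\<integral>\<^sup>+ w. (if T k w = 0 then 1 else 0) * indicator (D k) w \<partial>M) = (\<integral>\<^sup>+ w. (if T k w = 0 then 1 else 0) * T k w \<partial>M)"
      by (rule T_int[symmetric]) measurable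
    also have "\<dots> = (\<integral>\<^sup>+ w. 0 \<partial>M)" by (intro nn_integral_cong) auto
    also have "\<dots> = 0" by simp
    finally have "AE w in M. (if T k w = 0 then 1 else 0) * indicator (D k) w = (0 :: ennreal)"
      by (subst (asm) nn_integral_0_iff_AE) auto
    then show ?thesis
      using AE_space by eventually_elim (auto simp: D_def indicator_def split: if_splits)
  qed
  then have "AE w in M. \<forall>k. T k w = 0 \<longrightarrow> \<bar>y w\<bar> \<le> 4^k" by (simp add: AE_all_countable)
  then have "AE w in M. \<bar>y w\<bar> \<le> \<eta> w"
    using nB AE_space
  proof eventually_elim
    case (elim w)
    then have "\<exists>k. T k w = 0" using subalg by (auto simp: B_def subalgebra_def)
    then have "T (LEAST k. T k w = 0) w = 0" by (rule LeastI_ex)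
    then show ?case using elim by (simp add: \<eta>_def)
  qed
  then show ?thesis using \<eta>_meas by (auto simp: L_cond_def)
qed

text \<open>\<open>B\<close> is the set where E[|y|^s|F] is infinite. With t a truncation of |y| and
  \<sigma> = E[t^s|F], the function u = t^(s-1) \<sigma>^(-1/r) is the equality case of Hoelder's
  inequality: on \<open>A k\<close> one has E[u^r|F] = 1 and E[u |y| |F] \<ge> \<sigma>^(1/s), which
  is large there.\<close>

lemma kothe_dual_subset_finite:
  assumes q: "q < \<infinity>" and r1: "1 < r" and s1: "1 < enn2real q" and rs: "1 / r + 1 / enn2real q = 1"
    and y: "y \<in> kothe_dual M F X"
  shows "y \<in> L_cond M F q"
proof -
  define s where "s = enn2real q"
  have s: "1 < s" "1 / r + 1 / s = 1" "(s - 1) * r = s"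
    using s1 rs r1 by (simp_all add: s_def field_simps)
  have [measurable]: "y \<in> borel_measurable M" using y by (simp add: kothe_dual_def)
  \<comment> \<open>Truncation keeps the conditional s-th moments \<open>S n\<close> finite, so they
    can be used for normalization; they increase to \<open>G\<close>.\<close>
  define t where "t n w = min \<bar>y w\<bar> (real n)" for n w
  have [measurable]: "t n \<in> borel_measurable M" for n by (simp add: t_def[abs_def])
  have t0: "0 \<le> t n w" and t_le: "t n w \<le> \<bar>y w\<bar>" for n w by (auto simp: t_def)
  define S where "S n = nn_cond_exp M F (\<lambda>w. ennreal (t n w powr s))" for n
  define G where "G = nn_cond_exp M F (\<lambda>w. ennreal (\<bar>y w\<bar> powr s))"
  have S_meas[measurable]: "S n \<in> borel_measurable F" for n by (simp add: S_def)
  have G_meas[measurable]: "G \<in> borel_measurable F" by (simp add: G_def)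
  note [measurable] = F_measurable[OF S_meas] F_measurable[OF G_meas]
  have S_int: "(\<integral>\<^sup>+ w. g w * S k w \<partial>M) = (\<integral>\<^sup>+ w. g w * ennreal (t k w powr s) \<partial>M)" if "g \<in> borel_measurable F" for g k
    unfolding S_def using that by (intro nn_cond_exp_intg) auto
  have S_fin: "AE w in M. S n w < \<infinity>" for n
  proof -
    have "AE w in M. S n w \<le> nn_cond_exp M F (\<lambda>w. ennreal (real n powr s)) w"
      unfolding S_def using s(1) by (intro nn_cond_exp_mono) (auto simp: t_def intro!: ennreal_leI powr_mono2)
    moreover have "AE w in M. ennreal (real n powr s) = nn_cond_exp M F (\<lambda>w. ennreal (real n powr s)) w"
      by (rule nn_cond_exp_F_meas) auto
    ultimately show ?thesis
      by eventually_elim (metis ennreal_less_top infinity_ennreal_def le_less_trans)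
  qed
  have "(SUP n. ennreal (t n w powr s)) = ennreal (\<bar>y w\<bar> powr s)" for w
  proof (rule antisym)
    show "(SUP n. ennreal (t n w powr s)) \<le> ennreal (\<bar>y w\<bar> powr s)"
      using s(1) t0 t_le by (intro SUP_least ennreal_leI powr_mono2) auto
    obtain n where "\<bar>y w\<bar> \<le> real n" using real_arch_simple by blast
    then have "t n w = \<bar>y w\<bar>" by (simp add: t_def)
    then show "ennreal (\<bar>y w\<bar> powr s) \<le> (SUP n. ennreal (t n w powr s))"
      by (intro SUP_upper2[of n]) auto
  qed
  moreover have "ennreal (t n w powr s) \<le> ennreal (t (Suc n) w powr s)" for n w
    using s(1) by (auto simp: t_def intro!: ennreal_leI powr_mono2)
  ultimately have S_lim: "AE w in M. incseq (\<lambda>n. S n w) \<and> (SUP n. S n w) = G w"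
    using nn_cond_exp_monotone_convergence[of "\<lambda>n w. ennreal (t n w powr s)"]
    by (simp add: S_def G_def)
  define B where "B = {w \<in> space F. G w = \<infinity>}"
  have BF[measurable]: "B \<in> sets F" by (simp add: B_def)
  have [measurable]: "B \<in> sets M" by (rule F_sets[OF BF])
  \<comment> \<open>With this threshold, \<sigma> \<ge> c k yields \<sigma>^(1/s) \<ge> 4^k, the
    growth that the gliding hump requires.\<close>
  define c where "c k = (4 ^ k) powr s" for k :: nat
  have c1: "1 \<le> c k" for k using s(1) by (simp add: c_def ge_one_powr_ge_zero)
  \<comment> \<open>On \<open>B\<close> the moments \<open>S n\<close> increase to infinity, so the
    part of \<open>B\<close> where they are still below \<open>c k\<close> shrinks to measure
    0.\<close>
  have "\<exists>n. emeasure M (B \<inter> {w \<in> space M. S n w < ennreal (c k)}) < ennreal ((1/2)^k)" for k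
  proof -
    define E where "E n = B \<inter> {w \<in> space M. S n w < ennreal (c k)}" for n
    have [measurable]: "E n \<in> sets M" for n unfolding E_def by measurable
    have "(\<lambda>n. \<integral>\<^sup>+ w. indicator (E n) w \<partial>M) \<longlonglongrightarrow> (\<integral>\<^sup>+ w. 0 \<partial>M)"
    proof (rule nn_integral_dominated_convergence[where w = "\<lambda>w. 1"])
      show "AE w in M. (\<lambda>n. indicator (E n) w :: ennreal) \<longlonglongrightarrow> 0"
        using S_lim
      proof eventually_elim
        case (elim w)
        show ?case
        proof (cases "w \<in> B")
          case True
          then have "(\<lambda>n. S n w) \<longlonglongrightarrow> \<infinity>" using elim LIMSEQ_SUP by (metis (mono_tags, lifting) B_def mem_Collect_eq)
          then have "eventually (\<lambda>n. ennreal (c k) < S n w) sequentially"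
            by (rule order_tendstoD) simp
          then have "eventually (\<lambda>n. indicator (E n) w = (0 :: ennreal)) sequentially"
            by eventually_elim (auto simp: E_def indicator_def dest: less_asym)
          then show ?thesis by (rule tendsto_eventually)
        qed (simp add: E_def)
      qed
    qed (auto simp: emeasure_space_1 split: split_indicator)
    then have "(\<lambda>n. emeasure M (E n)) \<longlonglongrightarrow> 0" by simp
    then have "eventually (\<lambda>n. emeasure M (E n) < ennreal ((1/2)^k)) sequentially"
      by (rule order_tendstoD) simp
    then show ?thesis by (auto simp: eventually_sequentially E_def)
  qed
  then obtain N where N: "\<And>k. emeasure M (B \<inter> {w \<in> space M. S (N k) w < ennreal (c k)}) < ennreal ((1/2)^k)"
    by metis
  define A where "A k = {w \<in> space F. ennreal (c k) \<le> S (N k) w}" for k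
  have AF[measurable]: "A k \<in> sets F" for k by (simp add: A_def)
  have [measurable]: "A k \<in> sets M" for k by (rule F_sets[OF AF])
  define \<sigma> where "\<sigma> k w = enn2real (S (N k) w)" for k w
  have \<sigma>F[measurable]: "\<sigma> k \<in> borel_measurable F" for k unfolding \<sigma>_def[abs_def] by measurable
  note [measurable] = F_measurable[OF \<sigma>F]
  have \<sigma>: "AE w in M. S (N k) w = ennreal (\<sigma> k w) \<and> (w \<in> A k \<longrightarrow> c k \<le> \<sigma> k w)" for k
    using S_fin[of "N k"]
  proof eventually_elim
    case (elim w)
    then obtain b where "S (N k) w = ennreal b" "0 \<le> b" by (cases "S (N k) w") auto
    then show ?case using c1[of k] by (auto simp: \<sigma>_def A_def)
  qed
  \<comment> \<open>The exponent -1/r normalizes the r-th moment, because (s - 1) r = s turns u^r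
    into t^s / \<sigma> on \<open>A k\<close>.\<close>
  define u where "u k w = indicator (A k) w * t (N k) w powr (s - 1) * \<sigma> k w powr (- 1 / r)" for k w
  have u0: "0 \<le> u k w" for k w by (simp add: u_def)
  have "B \<in> null_sets M"
  proof (rule kothe_gliding_hump[OF y, where u = u and A = A])
    show "u k \<in> borel_measurable M" for k unfolding u_def[abs_def] by measurable
    show "emeasure M (B - A k) \<le> ennreal ((1/2)^k)" for k
    proof -
      have "B - A k = B \<inter> {w \<in> space M. S (N k) w < ennreal (c k)}"
        using subalg by (auto simp: B_def A_def subalgebra_def not_le)
      then show ?thesis using N[of k] by simp
    qed
    show "(\<integral>\<^sup>+ w. ennreal (u k w powr r) \<partial>M) \<le> 1" for k
    proof -
      have "(\<integral>\<^sup>+ w. ennreal (u k w powr r) \<partial>M)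
          = (\<integral>\<^sup>+ w. (indicator (A k) w * ennreal (\<sigma> k w powr - 1)) * ennreal (t (N k) w powr s) \<partial>M)"
      proof (rule nn_integral_cong)
        fix w
        have "u k w powr r = indicator (A k) w * \<sigma> k w powr - 1 * t (N k) w powr s"
          using r1 s(3) by (auto simp: u_def powr_mult powr_powr split: split_indicator)
        then show "ennreal (u k w powr r) = (indicator (A k) w * ennreal (\<sigma> k w powr - 1)) * ennreal (t (N k) w powr s)"
          by (simp only: ennreal_mult ennreal_indicator mult_nonneg_nonneg powr_ge_zero indicator_pos_le)
      qed
      also have "\<dots> = (\<integral>\<^sup>+ w. (indicator (A k) w * ennreal (\<sigma> k w powr - 1)) * S (N k) w \<partial>M)"
        by (rule S_int[symmetric]) measurable
      also have "\<dots> = (\<integral>\<^sup>+ w. indicator (A k) w \<partial>M)"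
      proof (rule nn_integral_cong_AE, use \<sigma>[of k] in eventually_elim)
        case (elim w)
        then show ?case using c1[of k]
          by (auto simp: powr_minus_divide split: split_indicator simp flip: ennreal_mult)
      qed
      also have "\<dots> \<le> 1" by (simp add: emeasure_le_1)
      finally show ?thesis .
    qed
    fix k h assume h: "h \<in> weights"
    note [measurable] = weightsD(1)[OF h] weightsD(2)[OF h]
    have "ennreal (4^k) * (\<integral>\<^sup>+ w. ennreal (h w) * indicator (A k) w \<partial>M)
        = (\<integral>\<^sup>+ w. ennreal (4^k) * (ennreal (h w) * indicator (A k) w) \<partial>M)"
      by (rule nn_integral_cmult[symmetric]) measurable
    also have "\<dots> \<le> (\<integral>\<^sup>+ w. (ennreal (h w) * indicator (A k) w * ennreal (\<sigma> k w powr (- 1 / r))) * S (N k) w \<partial>M)"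
    proof (rule nn_integral_mono_AE, use \<sigma>[of k] in eventually_elim)
      case (elim w)
      show ?case
      proof (cases "w \<in> A k")
        case True
        then have ge: "c k \<le> \<sigma> k w" and pos: "0 < \<sigma> k w" using elim c1[of k] by auto
        have "4^k = (c k) powr (1 / s)" using s(1) by (simp add: c_def powr_powr)
        also have "\<dots> \<le> \<sigma> k w powr (1 / s)" using ge s(1) c1[of k] by (intro powr_mono2) auto
        also have "1 / s = - 1 / r + 1" using s(2) by simp
        also have "\<sigma> k w powr (- 1 / r + 1) = \<sigma> k w powr (- 1 / r) * \<sigma> k w"
          using pos by (subst powr_add) simp
        finally have "h w * 4^k \<le> h w * (\<sigma> k w powr (- 1 / r) * \<sigma> k w)"
          using weightsD(5)[OF h] by (rule mult_left_mono)
        then show ?thesis using True elim pos weightsD(5)[OF h, of w]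
          by (simp add: ennreal_leI mult_ac flip: ennreal_mult)
      qed simp
    qed
    also have "\<dots> = (\<integral>\<^sup>+ w. (ennreal (h w) * indicator (A k) w * ennreal (\<sigma> k w powr (- 1 / r))) * ennreal (t (N k) w powr s) \<partial>M)"
      by (rule S_int) measurable
    also have "\<dots> \<le> (\<integral>\<^sup>+ w. ennreal (h w * (u k w * \<bar>y w\<bar>)) \<partial>M)"
    proof (rule nn_integral_mono)
      fix w
      have "t (N k) w powr s = t (N k) w powr (s - 1) * t (N k) w"
        using t0[of "N k" w] powr_mult_base[of "t (N k) w" "s - 1"] by (simp add: mult.commute)
      also have "\<dots> \<le> t (N k) w powr (s - 1) * \<bar>y w\<bar>" using t_le by (intro mult_left_mono) auto
      finally have "h w * (indicator (A k) w * \<sigma> k w powr (- 1 / r)) * t (N k) w powr s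
          \<le> h w * (indicator (A k) w * \<sigma> k w powr (- 1 / r)) * (t (N k) w powr (s - 1) * \<bar>y w\<bar>)"
        using weightsD(5)[OF h] by (intro mult_left_mono) auto
      also have "\<dots> = h w * (u k w * \<bar>y w\<bar>)" by (simp add: u_def mult_ac)
      finally have "ennreal (h w * (indicator (A k) w * \<sigma> k w powr (- 1 / r)) * t (N k) w powr s) \<le> ennreal (h w * (u k w * \<bar>y w\<bar>))"
        by (rule ennreal_leI)
      then show "ennreal (h w) * indicator (A k) w * ennreal (\<sigma> k w powr (- 1 / r)) * ennreal (t (N k) w powr s) \<le> ennreal (h w * (u k w * \<bar>y w\<bar>))"
        using weightsD(5)[OF h, of w] by (auto simp flip: ennreal_mult split: split_indicator)
    qed
    finally show "ennreal (4^k) * (\<integral>\<^sup>+ w. ennreal (h w) * indicator (A k) w \<partial>M) \<le> (\<integral>\<^sup>+ w. ennreal (h w * (u k w * \<bar>y w\<bar>)) \<partial>M)" .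
  qed (auto simp: u0)
  then have "AE w in M. w \<notin> B" by (rule AE_not_in)
  then have "AE w in M. G w < \<infinity>"
    using AE_space by eventually_elim (use subalg in \<open>auto simp: B_def subalgebra_def less_top\<close>)
  then have "\<exists>h\<in>weights. (\<integral>\<^sup>+ w. ennreal (h w) * ennreal (\<bar>y w\<bar> powr s) \<partial>M) < \<infinity>"
    unfolding G_def by (subst (asm) nn_cond_exp_finite_iff) auto
  then obtain h where h: "h \<in> weights" "(\<integral>\<^sup>+ w. ennreal (h w) * ennreal (\<bar>y w\<bar> powr s) \<partial>M) < \<infinity>" by blast
  then have "(\<integral>\<^sup>+ w. ennreal (h w * \<bar>y w\<bar> powr s) \<partial>M) < \<infinity>"
    by (simp add: ennreal_mult weightsD(5)[OF h(1)])
  then show ?thesis using h(1) L_cond_iff[OF q] by (auto simp: s_def)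
qed

end

section \<open>Automatic continuity\<close>

locale cond_risk = cond_Lp +
  fixes \<rho> :: "('a \<Rightarrow> real) \<Rightarrow> 'a \<Rightarrow> real"
  assumes risk: "cond_risk_measure M F (L_cond M F p) \<rho>"
begin

lemma rho_measurable: "x \<in> X \<Longrightarrow> \<rho> x \<in> borel_measurable F"
  using risk by (simp add: cond_risk_measure_def)

lemma rho_convex:
  assumes "\<eta> \<in> borel_measurable F" "x \<in> X" "z \<in> X" "\<And>w. 0 \<le> \<eta> w" "\<And>w. \<eta> w \<le> 1"
  shows "AE w in M. \<rho> (\<lambda>w. \<eta> w * x w + (1 - \<eta> w) * z w) w \<le> \<eta> w * \<rho> x w + (1 - \<eta> w) * \<rho> z w"
  using risk assms by (simp add: cond_risk_measure_def)

lemma rho_mono: "x \<in> X \<Longrightarrow> z \<in> X \<Longrightarrow> AE w in M. x w \<le> z w \<Longrightarrow> AE w in M. \<rho> z w \<le> \<rho> x w"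
  using risk by (simp add: cond_risk_measure_def)

lemma rho_cash: "\<eta> \<in> borel_measurable F \<Longrightarrow> x \<in> X \<Longrightarrow> AE w in M. \<rho> (\<lambda>w. x w + \<eta> w) w = \<rho> x w - \<eta> w"
  using risk by (simp add: cond_risk_measure_def)

text \<open>Since \<open>z\<close> decreases, the values \<rho> (x - z n) decrease in n and stay
  above \<rho> x, so convergence along a subsequence is enough.\<close>

lemma rho_continuous_decreasing:
  assumes x: "x \<in> X" and [measurable]: "\<And>n::nat. z n \<in> borel_measurable M"
    and z0: "\<And>n w. 0 \<le> z n w" and dec: "\<And>w. decseq (\<lambda>n. z n w)"
    and Y: "Y \<in> X" "\<And>n w. z n w \<le> Y w"
    and lim: "AE w in M. (\<lambda>n. z n w) \<longlonglongrightarrow> 0"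
  shows "AE w in M. (\<lambda>n. \<rho> (\<lambda>w. x w - z n w) w) \<longlonglongrightarrow> \<rho> x w"
proof -
  obtain h where h: "h \<in> weights" and fin: "(\<integral>\<^sup>+ w. ennreal (h w * \<bar>Y w\<bar> powr r) \<partial>M) < \<infinity>"
    using Y by (auto simp: X_iff)
  note [measurable] = weightsD(2)[OF h] X_measurable[OF Y(1)]
  have zX: "z n \<in> X" for n
    by (rule X_solid[OF Y(1)]) (use Y(2)[of n] z0[of n] in \<open>auto intro!: AE_I2 order_trans[OF _ abs_ge_self]\<close>)
  define u where "u n w = ennreal (h w * z n w powr r)" for n w
  have [measurable]: "u n \<in> borel_measurable M" for n by (simp add: u_def[abs_def])
  have u_lim: "(\<lambda>n. \<integral>\<^sup>+ w. u n w \<partial>M) \<longlonglongrightarrow> (\<integral>\<^sup>+ w. 0 \<partial>M)"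
  proof (rule nn_integral_dominated_convergence[where w = "\<lambda>w. ennreal (h w * \<bar>Y w\<bar> powr r)"])
    show "AE w in M. u n w \<le> ennreal (h w * \<bar>Y w\<bar> powr r)" for n
    proof (rule AE_I2)
      fix w
      have "z n w \<le> \<bar>Y w\<bar>" using Y(2)[of n w] by simp
      then show "u n w \<le> ennreal (h w * \<bar>Y w\<bar> powr r)" unfolding u_def
        using r_ge_1 z0[of n w] weightsD(5)[OF h, of w]
        by (intro ennreal_leI mult_left_mono powr_mono2) auto
    qed
    show "AE w in M. (\<lambda>n. u n w) \<longlonglongrightarrow> 0"
      using lim
    proof eventually_elim
      case (elim w)
      have "(\<lambda>n. z n w powr r) \<longlonglongrightarrow> 0"
        by (rule tendsto_zero_powrI[OF elim tendsto_const]) (use z0 r_ge_1 in auto)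
      then have "(\<lambda>n. h w * z n w powr r) \<longlonglongrightarrow> h w * 0" by (intro tendsto_intros)
      then have "(\<lambda>n. u n w) \<longlonglongrightarrow> ennreal (h w * 0)" unfolding u_def by (rule tendsto_ennrealI)
      then show ?case by simp
    qed
  qed (use fin in auto)
  \<comment> \<open>The threshold anticipates the later multiplication of z by 2^k: the factor
    (2^k)^r cancels and leaves the summable bound 2^-k.\<close>
  have "\<exists>n. (\<integral>\<^sup>+ w. u n w \<partial>M) < ennreal ((1/2)^k / (2^k) powr r)" for k
  proof -
    have "eventually (\<lambda>n. (\<integral>\<^sup>+ w. u n w \<partial>M) < ennreal ((1/2)^k / (2^k) powr r)) sequentially"
      using u_lim by (rule order_tendstoD) (simp add: ennreal_zero_less_divide)
    then show ?thesis by (auto simp: eventually_sequentially)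
  qed
  then obtain N where N: "\<And>k. (\<integral>\<^sup>+ w. u (N k) w \<partial>M) < ennreal ((1/2)^k / (2^k) powr r)" by metis
  define v where "v k w = 2^k * z (N k) w" for k :: nat and w
  have v_int: "(\<integral>\<^sup>+ w. ennreal (h w * v k w powr r) \<partial>M) \<le> ennreal ((1/2)^k)" for k
  proof -
    have "(\<integral>\<^sup>+ w. ennreal (h w * v k w powr r) \<partial>M) = (\<integral>\<^sup>+ w. ennreal ((2^k) powr r) * u (N k) w \<partial>M)"
      using z0 weightsD(5)[OF h]
      by (intro nn_integral_cong) (simp add: v_def u_def powr_mult mult.left_commute flip: ennreal_mult)
    also have "\<dots> = ennreal ((2^k) powr r) * (\<integral>\<^sup>+ w. u (N k) w \<partial>M)"
      by (rule nn_integral_cmult) measurable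
    also have "\<dots> \<le> ennreal ((2^k) powr r) * ennreal ((1/2)^k / (2^k) powr r)"
      using N[of k] by (intro mult_left_mono) auto
    also have "\<dots> = ennreal ((1/2)^k)" by (simp flip: ennreal_mult)
    finally show ?thesis .
  qed
  have "(\<Sum>k. \<integral>\<^sup>+ w. ennreal (h w * v k w powr r) \<partial>M) \<le> (\<Sum>k. ennreal ((1/2)^k))"
    by (intro suminf_le v_int) auto
  also have "\<dots> = ennreal (\<Sum>k. (1/2)^k)"
    by (rule suminf_ennreal_eq) (auto intro!: summable_sums simp: summable_geometric)
  finally have "(\<Sum>k. \<integral>\<^sup>+ w. ennreal (h w * v k w powr r) \<partial>M) < \<infinity>"
    by (rule le_less_trans) simp
  moreover have "v k \<in> borel_measurable M" "0 \<le> v k w" for k w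
    using z0 by (auto simp: v_def[abs_def])
  ultimately obtain W where W: "W \<in> X" "AE w in M. \<forall>k. v k w \<le> W w"
    using X_majorant[OF h, of v] by metis
  have hump: "AE w in M. \<rho> (\<lambda>w. x w - z (N k) w) w \<le> (1/2)^k * \<rho> (\<lambda>w. x w - W w) w + (1 - (1/2)^k) * \<rho> x w" for k
  proof -
    \<comment> \<open>The convex combination equals x - 2^-k W, which lies below x - z (N k) almost
      everywhere.\<close>
    have "AE w in M. \<rho> (\<lambda>w. x w - z (N k) w) w \<le> \<rho> (\<lambda>w. (1/2)^k * (x w - W w) + (1 - (1/2)^k) * x w) w"
    proof (rule rho_mono)
      show "AE w in M. (1/2)^k * (x w - W w) + (1 - (1/2)^k) * x w \<le> x w - z (N k) w"
        using W(2) by eventually_elim (auto simp: v_def field_simps dest!: spec[of _ k])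
    qed (intro X_add X_cmult X_diff x W zX)+
    moreover have "AE w in M. \<rho> (\<lambda>w. (1/2)^k * (x w - W w) + (1 - (1/2)^k) * x w) w
        \<le> (1/2)^k * \<rho> (\<lambda>w. x w - W w) w + (1 - (1/2)^k) * \<rho> x w"
      by (rule rho_convex) (auto intro!: X_diff x W power_le_one)
    ultimately show ?thesis by eventually_elim auto
  qed
  have lower: "AE w in M. \<rho> x w \<le> \<rho> (\<lambda>w. x w - z n w) w" for n
    by (rule rho_mono) (use z0 in \<open>auto intro!: X_diff x zX\<close>)
  have mono: "AE w in M. n \<le> m \<longrightarrow> \<rho> (\<lambda>w. x w - z m w) w \<le> \<rho> (\<lambda>w. x w - z n w) w" for n m
    by (cases "n \<le> m") (use decseqD[OF dec] in \<open>auto intro!: rho_mono X_diff x zX\<close>)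
  from hump lower mono
  have "AE w in M. (\<forall>k. \<rho> (\<lambda>w. x w - z (N k) w) w \<le> (1/2)^k * \<rho> (\<lambda>w. x w - W w) w + (1 - (1/2)^k) * \<rho> x w)
    \<and> (\<forall>n. \<rho> x w \<le> \<rho> (\<lambda>w. x w - z n w) w)
    \<and> (\<forall>n m. n \<le> m \<longrightarrow> \<rho> (\<lambda>w. x w - z m w) w \<le> \<rho> (\<lambda>w. x w - z n w) w)"
    by (simp add: AE_all_countable)
  then show ?thesis
  proof eventually_elim
    case (elim w)
    define a where "a n = \<rho> (\<lambda>w. x w - z n w) w" for n
    define b where "b = \<rho> (\<lambda>w. x w - W w) w - \<rho> x w"
    have a: "a (N k) \<le> \<rho> x w + (1/2)^k * b" "\<rho> x w \<le> a n" "n \<le> m \<Longrightarrow> a m \<le> a n" for k n m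
      using elim by (auto simp: a_def b_def algebra_simps)
    have "(\<lambda>k. (1/2)^k * b) \<longlonglongrightarrow> 0 * b"
      by (intro tendsto_intros LIMSEQ_power_zero) auto
    have "a \<longlonglongrightarrow> \<rho> x w"
    proof (rule LIMSEQ_I)
      fix e :: real assume "e > 0"
      then obtain k where "(1/2)^k * b < e"
        using order_tendstoD(2)[OF \<open>(\<lambda>k. (1/2)^k * b) \<longlonglongrightarrow> 0 * b\<close>, of e]
        by (auto simp: eventually_sequentially)
      then have "\<forall>n\<ge>N k. norm (a n - \<rho> x w) < e"
        using a(1)[of k] a(2) a(3)[of "N k"] by (smt (verit) real_norm_def)
      then show "\<exists>no. \<forall>n\<ge>no. norm (a n - \<rho> x w) < e" by blast
    qed
    then show ?case unfolding a_def[abs_def] .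
  qed
qed

text \<open>With z n the supremum over k \<ge> n of |x_k - x|, the sequence lies between x - z n and
  x + z n. The decreasing case controls \<rho> (x - z n), hence the upper bound; the lower bound
  follows from midpoint convexity, 2 \<rho> x \<le> \<rho> (x - z n) + \<rho> (x + z n).\<close>

lemma lebesgue_property_rho: "lebesgue_property M X \<rho>"
  unfolding lebesgue_property_def
proof (intro allI impI)
  fix xs :: "nat \<Rightarrow> 'a \<Rightarrow> real" and x y
  assume xs: "\<forall>n. xs n \<in> X" and x: "x \<in> X" and y: "y \<in> X"
    and lim: "AE w in M. (\<lambda>n. xs n w) \<longlonglongrightarrow> x w" and bound: "\<forall>n. AE w in M. \<bar>xs n w\<bar> \<le> y w"
  have [measurable]: "\<And>n. xs n \<in> borel_measurable M" "x \<in> borel_measurable M" "y \<in> borel_measurable M"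
    using xs x y by (auto intro: X_measurable)
  \<comment> \<open>The cut at 2|y| makes the suprema finite at every point, including the null set
    where the domination fails. Almost everywhere nothing is cut, since |x_k| \<le> y passes to the
    limit.\<close>
  define d where "d k w = min \<bar>xs k w - x w\<bar> (2 * \<bar>y w\<bar>)" for k w
  define z where "z n w = (SUP k\<in>{n..}. d k w)" for n w
  have d0: "0 \<le> d k w" and d_le: "d k w \<le> 2 * \<bar>y w\<bar>" for k w by (auto simp: d_def)
  have bdd: "bdd_above ((\<lambda>k. d k w) ` A)" for A w
    using d_le by (auto intro!: bdd_aboveI2)
  have d_z: "d k w \<le> z n w" if "n \<le> k" for k n w
    unfolding z_def by (rule cSUP_upper[OF _ bdd]) (use that in auto)
  have z_le: "z n w \<le> c" if "\<And>k. n \<le> k \<Longrightarrow> d k w \<le> c" for n w c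
    unfolding z_def by (rule cSUP_least) (use that in auto)
  have z_meas[measurable]: "z n \<in> borel_measurable M" for n
    unfolding z_def[abs_def] d_def by (rule borel_measurable_cSUP) (use bdd[unfolded d_def] in auto)
  have z0: "0 \<le> z n w" for n w using d0[of n w] d_z[of n n w] by simp
  have dec: "decseq (\<lambda>n. z n w)" for w
    by (rule decseq_SucI, rule z_le) (auto intro: d_z)
  have Y: "(\<lambda>w. 2 * \<bar>y w\<bar>) \<in> X" by (intro X_cmult X_abs y)
  have z_lim: "AE w in M. (\<lambda>n. z n w) \<longlonglongrightarrow> 0"
    using lim
  proof eventually_elim
    case (elim w)
    show ?case
    proof (rule LIMSEQ_I)
      fix e :: real assume e: "e > 0"
      obtain n0 where n0: "\<And>n. n \<ge> n0 \<Longrightarrow> norm (xs n w - x w) < e / 2"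
        using LIMSEQ_D[OF elim, of "e / 2"] e by auto
      have "norm (z n w - 0) < e" if "n \<ge> n0" for n
      proof -
        have "z n w \<le> e / 2"
        proof (rule z_le)
          fix k assume "n \<le> k"
          then have "\<bar>xs k w - x w\<bar> < e / 2" using n0[of k] that by simp
          moreover have "d k w \<le> \<bar>xs k w - x w\<bar>" by (simp add: d_def)
          ultimately show "d k w \<le> e / 2" by simp
        qed
        then show ?thesis using z0[of n w] e by simp
      qed
      then show "\<exists>no. \<forall>n\<ge>no. norm (z n w - 0) < e" by blast
    qed
  qed
  have zX: "z n \<in> X" for n
    by (rule X_solid[OF Y]) (use z_le[of n _ "2 * \<bar>y _\<bar>"] d_le z0 in auto)
  have "AE w in M. \<forall>n. \<bar>xs n w\<bar> \<le> y w" using bound by (simp add: AE_all_countable)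
  then have close: "AE w in M. \<forall>n. \<bar>xs n w - x w\<bar> \<le> z n w"
    using lim
  proof eventually_elim
    case (elim w)
    have "\<bar>x w\<bar> \<le> y w"
      by (rule LIMSEQ_le_const2[OF tendsto_rabs[OF elim(2)]]) (use elim(1) in auto)
    show ?case
    proof
      fix n
      have "\<bar>xs n w - x w\<bar> \<le> 2 * \<bar>y w\<bar>" using \<open>\<bar>x w\<bar> \<le> y w\<close> elim(1)[rule_format, of n] by linarith
      then show "\<bar>xs n w - x w\<bar> \<le> z n w" using d_z[of n n w] by (simp add: d_def)
    qed
  qed
  have up: "AE w in M. \<rho> (xs n) w \<le> \<rho> (\<lambda>w. x w - z n w) w" for n
    by (rule rho_mono) (use xs close in \<open>auto intro!: X_diff x zX elim!: eventually_mono dest!: spec[of _ n]\<close>)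
  have low: "AE w in M. 2 * \<rho> x w - \<rho> (\<lambda>w. x w - z n w) w \<le> \<rho> (xs n) w" for n
  proof -
    have "AE w in M. \<rho> (\<lambda>w. x w + z n w) w \<le> \<rho> (xs n) w"
      by (rule rho_mono) (use xs close in \<open>auto intro!: X_add x zX elim!: eventually_mono dest!: spec[of _ n]\<close>)
    moreover have "AE w in M. \<rho> (\<lambda>w. (1/2) * (x w - z n w) + (1 - 1/2) * (x w + z n w)) w
        \<le> (1/2) * \<rho> (\<lambda>w. x w - z n w) w + (1 - 1/2) * \<rho> (\<lambda>w. x w + z n w) w"
      by (rule rho_convex) (auto intro!: X_add X_diff x zX)
    ultimately show ?thesis by eventually_elim (simp add: field_simps)
  qed
  have "AE w in M. (\<lambda>n. \<rho> (\<lambda>w. x w - z n w) w) \<longlonglongrightarrow> \<rho> x w"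
    by (rule rho_continuous_decreasing[OF x z_meas z0 dec Y _ z_lim]) (use z_le d_le in auto)
  moreover have "AE w in M. \<forall>n. \<rho> (xs n) w \<le> \<rho> (\<lambda>w. x w - z n w) w" using up by (simp add: AE_all_countable)
  moreover have "AE w in M. \<forall>n. 2 * \<rho> x w - \<rho> (\<lambda>w. x w - z n w) w \<le> \<rho> (xs n) w"
    using low by (simp add: AE_all_countable)
  ultimately show "AE w in M. (\<lambda>n. \<rho> (xs n) w) \<longlonglongrightarrow> \<rho> x w"
  proof eventually_elim
    case (elim w)
    have "(\<lambda>n. 2 * \<rho> x w - \<rho> (\<lambda>w. x w - z n w) w) \<longlonglongrightarrow> 2 * \<rho> x w - \<rho> x w"
      by (intro tendsto_intros elim)
    then have "(\<lambda>n. 2 * \<rho> x w - \<rho> (\<lambda>w. x w - z n w) w) \<longlonglongrightarrow> \<rho> x w" by simp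
    then show ?case by (rule tendsto_sandwich[rotated 2, OF _ elim(1)]) (use elim in auto)
  qed
qed

end

section \<open>Subgradients\<close>

text \<open>Vectors are functions with the pointwise group structure. The scaling is supplied
  explicitly, which is why the Hahn-Banach part takes it as a parameter.\<close>

interpretation fun_space: real_vector_space "\<lambda>(c :: real) f w. c * f w"
  by unfold_locales (auto simp: fun_eq_iff algebra_simps)

context cond_risk begin

text \<open>Bounds hold at every point rather than almost everywhere, to match the set
  \<open>V\<close> of \<open>positive_functional_has_density\<close>.\<close>

definition bounded_functions :: "('a \<Rightarrow> real) set" where
  "bounded_functions = {d \<in> borel_measurable M. \<exists>K. \<forall>w. \<bar>d w\<bar> \<le> K}"

definition increment :: "('a \<Rightarrow> real) \<Rightarrow> ('a \<Rightarrow> real) \<Rightarrow> 'a \<Rightarrow> real" where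
  "increment x d w = \<rho> (\<lambda>w. x w + d w) w - \<rho> x w"

lemma bounded_functionsI: "d \<in> borel_measurable M \<Longrightarrow> (\<And>w. \<bar>d w\<bar> \<le> K) \<Longrightarrow> d \<in> bounded_functions"
  by (auto simp: bounded_functions_def)

lemma bounded_functionsE:
  assumes "d \<in> bounded_functions"
  obtains K where "d \<in> borel_measurable M" "\<And>w. \<bar>d w\<bar> \<le> K" "0 \<le> K"
proof -
  obtain K where "d \<in> borel_measurable M" "\<And>w. \<bar>d w\<bar> \<le> K" using assms by (auto simp: bounded_functions_def)
  moreover from this(2)[of undefined] have "0 \<le> K" by linarith
  ultimately show thesis by (rule that)
qed

lemma bounded_functions_X: "d \<in> bounded_functions \<Longrightarrow> d \<in> X"
  by (auto simp: bounded_functions_def intro: X_bounded)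

lemma bounded_functions_mult:
  assumes "d \<in> bounded_functions" "e \<in> bounded_functions"
  shows "(\<lambda>w. d w * e w) \<in> bounded_functions"
proof -
  obtain K L where [measurable]: "d \<in> borel_measurable M" "e \<in> borel_measurable M"
    and "\<And>w. \<bar>d w\<bar> \<le> K" "\<And>w. \<bar>e w\<bar> \<le> L" "0 \<le> K" "0 \<le> L"
    using assms by (metis bounded_functionsE)
  then show ?thesis by (intro bounded_functionsI[of _ "K * L"]) (auto simp: abs_mult intro!: mult_mono)
qed

lemma bounded_functions_add:
  assumes "d \<in> bounded_functions" "e \<in> bounded_functions"
  shows "(\<lambda>w. d w + e w) \<in> bounded_functions"
proof -
  obtain K L where [measurable]: "d \<in> borel_measurable M" "e \<in> borel_measurable M"
    and *: "\<And>w. \<bar>d w\<bar> \<le> K" "\<And>w. \<bar>e w\<bar> \<le> L"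
    using assms by (metis bounded_functionsE)
  show ?thesis
    by (intro bounded_functionsI[of _ "K + L"]) (auto intro: order_trans[OF abs_triangle_ineq] add_mono *)
qed

lemma bounded_functions_const: "(\<lambda>w. c) \<in> bounded_functions"
  by (rule bounded_functionsI[of _ "\<bar>c\<bar>"]) auto

lemma bounded_functions_cmult: "d \<in> bounded_functions \<Longrightarrow> (\<lambda>w. c * d w) \<in> bounded_functions"
  by (intro bounded_functions_mult bounded_functions_const)

lemma subspace_bounded_functions: "fun_space.subspace bounded_functions"
proof (rule fun_space.subspaceI)
  show "0 \<in> bounded_functions" using bounded_functions_const[of 0] by (simp add: zero_fun_def)
  show "d + e \<in> bounded_functions" if "d \<in> bounded_functions" "e \<in> bounded_functions" for d e
    using bounded_functions_add[OF that] by (simp add: plus_fun_def)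
  show "(\<lambda>w. c * d w) \<in> bounded_functions" if "d \<in> bounded_functions" for c d
    by (rule bounded_functions_cmult[OF that])
qed

section \<open>Increments of \<rho> at a fixed point\<close>

context
  fixes x
  assumes x: "x \<in> X"
begin

lemma increment_measurable: "d \<in> X \<Longrightarrow> increment x d \<in> borel_measurable F"
  unfolding increment_def[abs_def] by (intro borel_measurable_diff rho_measurable X_add x)

lemma increment_mono:
  assumes "d \<in> X" "e \<in> X" "AE w in M. d w \<le> e w"
  shows "AE w in M. increment x e w \<le> increment x d w"
proof -
  have "AE w in M. \<rho> (\<lambda>w. x w + e w) w \<le> \<rho> (\<lambda>w. x w + d w) w"
    using assms by (intro rho_mono X_add x) auto
  then show ?thesis by eventually_elim (simp add: increment_def)
qed

lemma increment_F_measurable: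
  assumes "\<eta> \<in> borel_measurable F"
  shows "AE w in M. increment x \<eta> w = - \<eta> w"
  using rho_cash[OF assms x] by eventually_elim (simp add: increment_def)

lemma increment_convex:
  assumes \<eta>: "\<eta> \<in> borel_measurable F" "\<And>w. 0 \<le> \<eta> w" "\<And>w. \<eta> w \<le> 1" and de: "d \<in> X" "e \<in> X"
  shows "AE w in M. increment x (\<lambda>w. \<eta> w * d w + (1 - \<eta> w) * e w) w \<le> \<eta> w * increment x d w + (1 - \<eta> w) * increment x e w"
proof -
  have "(\<lambda>w. \<eta> w * (x w + d w) + (1 - \<eta> w) * (x w + e w)) = (\<lambda>w. x w + (\<eta> w * d w + (1 - \<eta> w) * e w))"
    by (simp add: algebra_simps)
  moreover have "AE w in M. \<rho> (\<lambda>w. \<eta> w * (x w + d w) + (1 - \<eta> w) * (x w + e w)) w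
      \<le> \<eta> w * \<rho> (\<lambda>w. x w + d w) w + (1 - \<eta> w) * \<rho> (\<lambda>w. x w + e w) w"
    using \<eta> de by (intro rho_convex X_add x)
  ultimately show ?thesis by (simp add: increment_def algebra_simps)
qed

text \<open>Convexity between \<open>d\<close> and the direction 0, whose increment vanishes. With
  \<eta> an indicator of an F-set this is the locality of \<rho>.\<close>

lemma increment_scale:
  assumes \<eta>: "\<eta> \<in> borel_measurable F" "\<And>w. 0 \<le> \<eta> w" "\<And>w. \<eta> w \<le> 1" and d: "d \<in> X"
  shows "AE w in M. increment x (\<lambda>w. \<eta> w * d w) w \<le> \<eta> w * increment x d w"
  using increment_convex[OF \<eta> d X_const[of 0]] increment_F_measurable[of "\<lambda>w. 0"] by auto

lemma increment_bounded:
  assumes d: "d \<in> borel_measurable M" "\<And>w. \<bar>d w\<bar> \<le> K"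
  shows "AE w in M. \<bar>increment x d w\<bar> \<le> K"
proof -
  have dX: "d \<in> X" by (rule X_bounded[OF d])
  have "AE w in M. increment x (\<lambda>w. K) w \<le> increment x d w"
    using d(2) by (intro increment_mono X_const dX) (auto simp: abs_le_iff)
  moreover have "AE w in M. increment x d w \<le> increment x (\<lambda>w. - K) w"
    using d(2) by (intro increment_mono X_const dX AE_I2) (metis abs_le_iff minus_le_iff)
  moreover have "AE w in M. increment x (\<lambda>w. K) w = - K" "AE w in M. increment x (\<lambda>w. - K) w = - (- K)"
    by (rule increment_F_measurable, simp)+
  ultimately show ?thesis by eventually_elim auto
qed

lemma increment_integrable:
  assumes "d \<in> bounded_functions"
  shows "integrable M (increment x d)"
proof -
  obtain K where K: "d \<in> borel_measurable M" "\<And>w. \<bar>d w\<bar> \<le> K" "0 \<le> K"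
    by (rule bounded_functionsE[OF assms]) blast
  show ?thesis
  proof (rule integrable_const_bound)
    show "AE w in M. norm (increment x d w) \<le> K" using increment_bounded[OF K(1,2)] by simp
    show "increment x d \<in> borel_measurable M"
      by (intro F_measurable increment_measurable bounded_functions_X assms)
  qed
qed

lemma increment_tendsto:
  assumes d: "\<And>n::nat. d n \<in> X" "e \<in> X" "Y \<in> X" "\<And>n. AE w in M. \<bar>d n w\<bar> \<le> Y w"
    and lim: "AE w in M. (\<lambda>n. d n w) \<longlonglongrightarrow> e w"
  shows "AE w in M. (\<lambda>n. increment x (d n) w) \<longlonglongrightarrow> increment x e w"
proof -
  have "AE w in M. (\<lambda>n. \<rho> (\<lambda>w. x w + d n w) w) \<longlonglongrightarrow> \<rho> (\<lambda>w. x w + e w) w"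
  proof (rule lebesgue_property_rho[unfolded lebesgue_property_def, rule_format])
    show "(\<lambda>w. \<bar>x w\<bar> + Y w) \<in> X" by (intro X_add X_abs x d)
    show "AE w in M. (\<lambda>n. x w + d n w) \<longlonglongrightarrow> x w + e w"
      using lim by eventually_elim (intro tendsto_intros)
    show "AE w in M. \<bar>x w + d n w\<bar> \<le> \<bar>x w\<bar> + Y w" for n
      using d(4)[of n] by eventually_elim linarith
  qed (intro X_add x d)+
  then show ?thesis unfolding increment_def by eventually_elim (intro tendsto_intros)
qed

section \<open>The averaged increment, its linear minorant and the density\<close>

definition mean_increment :: "('a \<Rightarrow> real) \<Rightarrow> real" where
  "mean_increment d = (\<integral>w. increment x d w \<partial>M)"

lemma mean_increment_tendsto:
  assumes [measurable]: "\<And>n::nat. d n \<in> borel_measurable M" and K: "\<And>n w. \<bar>d n w\<bar> \<le> K"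
    and lim: "AE w in M. (\<lambda>n. d n w) \<longlonglongrightarrow> 0"
  shows "(\<lambda>n. mean_increment (d n)) \<longlonglongrightarrow> 0"
proof -
  have dX: "d n \<in> X" for n by (rule X_bounded[of _ K]) (auto simp: K)
  have zero: "AE w in M. increment x (\<lambda>w. 0) w = 0"
    using increment_F_measurable[of "\<lambda>w. 0"] by simp
  have [measurable]: "increment x (d n) \<in> borel_measurable M" for n
    by (intro F_measurable increment_measurable dX)
  have "(\<lambda>n. \<integral>w. increment x (d n) w \<partial>M) \<longlonglongrightarrow> (\<integral>w. 0 \<partial>M)"
  proof (rule integral_dominated_convergence[where w = "\<lambda>w. K"])
    have "AE w in M. (\<lambda>n. increment x (d n) w) \<longlonglongrightarrow> increment x (\<lambda>w. 0) w"
      by (rule increment_tendsto[OF dX X_const X_const[of K] _ lim]) (simp add: K)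
    with zero show "AE w in M. (\<lambda>n. increment x (d n) w) \<longlonglongrightarrow> 0" by eventually_elim simp
    show "AE w in M. norm (increment x (d n) w) \<le> K" for n
      using increment_bounded[of "d n" K] K by simp
  qed auto
  then show ?thesis by (simp add: mean_increment_def)
qed

lemma mean_increment_linear_minorant:
  obtains l where "\<And>d. d \<in> bounded_functions \<Longrightarrow> l d \<le> mean_increment d"
    "\<And>d e. d \<in> bounded_functions \<Longrightarrow> e \<in> bounded_functions \<Longrightarrow> l (\<lambda>w. d w + e w) = l d + l e"
    "\<And>c d. d \<in> bounded_functions \<Longrightarrow> l (\<lambda>w. c * d w) = c * l d"
proof -
  have r0: "mean_increment 0 = 0"
  proof -
    have "mean_increment 0 = (\<integral>w. 0 \<partial>M)"
      unfolding mean_increment_def zero_fun_def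
      using increment_F_measurable[of "\<lambda>w. 0"] increment_measurable[OF X_const[of 0], THEN F_measurable]
      by (intro integral_cong_AE) auto
    then show ?thesis by simp
  qed
  have conv: "mean_increment ((\<lambda>w. t * d w) + (\<lambda>w. (1 - t) * e w)) \<le> t * mean_increment d + (1 - t) * mean_increment e"
    if "d \<in> bounded_functions" "e \<in> bounded_functions" "0 \<le> t" "t \<le> 1" for d e t
  proof -
    have "mean_increment ((\<lambda>w. t * d w) + (\<lambda>w. (1 - t) * e w))
        = (\<integral>w. increment x (\<lambda>w. t * d w + (1 - t) * e w) w \<partial>M)"
      by (simp add: mean_increment_def plus_fun_def)
    also have "\<dots> \<le> (\<integral>w. t * increment x d w + (1 - t) * increment x e w \<partial>M)"
    proof (rule integral_mono_AE)
      show "AE w in M. increment x (\<lambda>w. t * d w + (1 - t) * e w) w \<le> t * increment x d w + (1 - t) * increment x e w"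
        using increment_convex[of "\<lambda>w. t" d e] that bounded_functions_X by auto
    qed (intro increment_integrable bounded_functions_add bounded_functions_cmult that
          Bochner_Integration.integrable_add integrable_mult_right)+
    also have "\<dots> = t * mean_increment d + (1 - t) * mean_increment e"
      using that increment_integrable by (simp add: mean_increment_def)
    finally show ?thesis .
  qed
  obtain l where "\<And>d. d \<in> bounded_functions \<Longrightarrow> l d \<le> mean_increment d"
    "\<And>d e. d \<in> bounded_functions \<Longrightarrow> e \<in> bounded_functions \<Longrightarrow> l (d + e) = l d + l e"
    "\<And>c d. d \<in> bounded_functions \<Longrightarrow> l (\<lambda>w. c * d w) = c * l d"
    using fun_space.convex_dominates_linear[OF subspace_bounded_functions, where r = mean_increment, OF r0 conv] by blast
  then show thesis by (intro that[of l]) (auto simp: plus_fun_def)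
qed

text \<open>\<rho> is decreasing, so a linear minorant \<open>l\<close> is nonpositive on
  nonnegative directions. The density theorem is applied to \<open>- l\<close>, and the sign is
  restored at the end.\<close>

lemma density_minorant:
  obtains y where "y \<in> borel_measurable M" "\<And>w. y w \<le> 0" "integrable M y"
    "\<And>d. d \<in> bounded_functions \<Longrightarrow> (\<integral>w. d w * y w \<partial>M) \<le> mean_increment d"
proof -
  obtain l where l_le: "\<And>d. d \<in> bounded_functions \<Longrightarrow> l d \<le> mean_increment d"
    and l_add: "\<And>d e. d \<in> bounded_functions \<Longrightarrow> e \<in> bounded_functions \<Longrightarrow> l (\<lambda>w. d w + e w) = l d + l e"
    and l_cmult: "\<And>c d. d \<in> bounded_functions \<Longrightarrow> l (\<lambda>w. c * d w) = c * l d"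
    using mean_increment_linear_minorant by blast
  have l_minus: "l (\<lambda>w. - d w) = - l d" if "d \<in> bounded_functions" for d
    using l_cmult[OF that, of "-1"] by simp
  have pos: "0 \<le> - l d" if d: "d \<in> bounded_functions" "\<And>w. 0 \<le> d w" for d
  proof -
    have dX: "d \<in> X" by (rule bounded_functions_X[OF d(1)])
    have "AE w in M. increment x d w \<le> increment x (\<lambda>w. 0) w"
      using d(2) by (intro increment_mono X_const dX) auto
    moreover have "AE w in M. increment x (\<lambda>w. 0) w = 0"
      using increment_F_measurable[of "\<lambda>w. 0"] by simp
    ultimately have "AE w in M. increment x d w \<le> 0" by eventually_elim auto
    then have "0 \<le> (\<integral>w. - increment x d w \<partial>M)"
      by (intro integral_nonneg_AE) (auto elim: eventually_mono)
    then have "mean_increment d \<le> 0" by (simp add: mean_increment_def)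
    then show ?thesis using l_le[OF d(1)] by simp
  qed
  \<comment> \<open>Linearity turns the one-sided bound into a two-sided one: \<open>- l d\<close>
    equals \<open>l\<close> at the direction -d, so it lies between - mean_increment(d) and
    mean_increment(-d). Both ends tend to 0.\<close>
  have cont: "(\<lambda>n. - l (d n)) \<longlonglongrightarrow> 0"
    if d: "\<And>n::nat. d n \<in> borel_measurable M" "\<And>n w. \<bar>d n w\<bar> \<le> K" "AE w in M. (\<lambda>n. d n w) \<longlonglongrightarrow> 0" for d K
  proof (rule tendsto_sandwich)
    have dB: "d n \<in> bounded_functions" "(\<lambda>w. - d n w) \<in> bounded_functions" for n
      using d by (auto intro!: bounded_functionsI[of _ K])
    show "\<forall>\<^sub>F n in sequentially. - mean_increment (d n) \<le> - l (d n)"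
      using l_le[OF dB(1)] by simp
    show "\<forall>\<^sub>F n in sequentially. - l (d n) \<le> mean_increment (\<lambda>w. - d n w)"
      using l_le[OF dB(2)] l_minus[OF dB(1)] by simp
    show "(\<lambda>n. - mean_increment (d n)) \<longlonglongrightarrow> 0"
      using tendsto_minus[OF mean_increment_tendsto[OF d]] by simp
    have "AE w in M. (\<lambda>n. - d n w) \<longlonglongrightarrow> 0" using d(3) by eventually_elim (use tendsto_minus in force)
    then show "(\<lambda>n. mean_increment (\<lambda>w. - d n w)) \<longlonglongrightarrow> 0"
      using d by (intro mean_increment_tendsto[of _ K]) auto
  qed
  obtain y where y: "y \<in> borel_measurable M" "\<And>w. 0 \<le> y w" "integrable M y"
    "\<And>d. d \<in> bounded_functions \<Longrightarrow> - l d = (\<integral>w. d w * y w \<partial>M)"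
  proof (rule positive_functional_has_density[where m = "\<lambda>d. - l d", folded bounded_functions_def])
    show "- l (\<lambda>w. d w + e w) = - l d + - l e" if "d \<in> bounded_functions" "e \<in> bounded_functions" for d e
      using l_add[OF that] by simp
    show "- l (\<lambda>w. c * d w) = c * - l d" if "d \<in> bounded_functions" for c d
      using l_cmult[OF that] by simp
  qed (use pos cont in blast)+
  show thesis
  proof (rule that[of "\<lambda>w. - y w"])
    show "(\<integral>w. d w * - y w \<partial>M) \<le> mean_increment d" if "d \<in> bounded_functions" for d
      using y(4)[OF that] l_le[OF that] by simp
  qed (use y in auto)
qed

text \<open>Scaling by an \<open>F\<close>-measurable \<open>\<eta>\<close> localizes the inequality between the means.\<close>

lemma density_minorant_local:
  assumes y: "\<And>d. d \<in> bounded_functions \<Longrightarrow> (\<integral>w. d w * y w \<partial>M) \<le> mean_increment d"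
    and \<eta>: "\<eta> \<in> borel_measurable F" "\<And>w. 0 \<le> \<eta> w" "\<And>w. \<eta> w \<le> 1" and d: "d \<in> bounded_functions"
  shows "integrable M (\<lambda>w. \<eta> w * increment x d w)"
    "(\<integral>w. \<eta> w * d w * y w \<partial>M) \<le> (\<integral>w. \<eta> w * increment x d w \<partial>M)"
proof -
  have \<eta>B: "\<eta> \<in> bounded_functions" using \<eta> by (intro bounded_functionsI[of _ 1] F_measurable) auto
  have \<eta>d: "(\<lambda>w. \<eta> w * d w) \<in> bounded_functions" by (rule bounded_functions_mult[OF \<eta>B d])
  show int: "integrable M (\<lambda>w. \<eta> w * increment x d w)"
  proof (rule Bochner_Integration.integrable_bound[OF increment_integrable[OF d]])
    show "(\<lambda>w. \<eta> w * increment x d w) \<in> borel_measurable M"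
      using \<eta> d by (intro borel_measurable_times F_measurable increment_measurable bounded_functions_X)
    show "AE w in M. norm (\<eta> w * increment x d w) \<le> norm (increment x d w)"
      using \<eta> by (intro AE_I2) (auto simp: abs_mult intro!: mult_left_le_one_le)
  qed
  have "(\<integral>w. \<eta> w * d w * y w \<partial>M) \<le> mean_increment (\<lambda>w. \<eta> w * d w)" by (rule y[OF \<eta>d])
  also have "\<dots> \<le> (\<integral>w. \<eta> w * increment x d w \<partial>M)"
    unfolding mean_increment_def using increment_scale[OF \<eta> bounded_functions_X[OF d]]
    by (intro integral_mono_AE increment_integrable \<eta>d int)
  finally show "(\<integral>w. \<eta> w * d w * y w \<partial>M) \<le> (\<integral>w. \<eta> w * increment x d w \<partial>M)" .
qed

end

end

section \<open>Conditional inequalities from integrals, and additivity of extended conditional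
  expectations\<close>

context prob_subalgebra begin

text \<open>The hypothesis is tested on the F-set where the inequality fails. There the difference
  E[u|F] - g is positive but has integral at most 0, so the set is null.\<close>

lemma real_cond_exp_leI:
  assumes u[measurable]: "integrable M u" and g: "integrable M g" and [measurable]: "g \<in> borel_measurable F"
    and le: "\<And>A. A \<in> sets F \<Longrightarrow> (\<integral>w. indicator A w * u w \<partial>M) \<le> (\<integral>w. indicator A w * g w \<partial>M)"
  shows "AE w in M. real_cond_exp M F u w \<le> g w"
proof -
  define A where "A = {w \<in> space F. g w < real_cond_exp M F u w}"
  have AF[measurable]: "A \<in> sets F" by (simp add: A_def)
  have AM[measurable]: "A \<in> sets M" by (rule F_sets[OF AF])
  have iu: "integrable M (\<lambda>w. indicator A w * u w)" and ig: "integrable M (\<lambda>w. indicator A w * g w)"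
    using integrable_mult_indicator[OF AM u] integrable_mult_indicator[OF AM g] by simp_all
  note c = real_cond_exp_intg[OF iu borel_measurable_indicator[OF AF] borel_measurable_integrable[OF u]]
  define f where "f w = indicator A w * real_cond_exp M F u w - indicator A w * g w" for w
  have f_int: "integrable M f" unfolding f_def by (intro Bochner_Integration.integrable_diff c ig)
  have f0: "0 \<le> f w" for w by (auto simp: f_def A_def split: split_indicator)
  have "(\<integral>w. f w \<partial>M) \<le> 0"
    using le[OF AF] c ig by (simp add: f_def)
  moreover have "0 \<le> (\<integral>w. f w \<partial>M)" using f0 by (intro integral_nonneg_AE) auto
  ultimately have "(\<integral>w. f w \<partial>M) = 0" by simp
  then have "AE w in M. f w = 0"
    using integral_nonneg_eq_0_iff_AE[OF f_int] f0 by auto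
  then show ?thesis
    using AE_space
  proof eventually_elim
    case (elim w)
    then have "w \<in> space F" using subalg by (simp add: subalgebra_def)
    then show ?case using elim by (auto simp: f_def A_def split: split_indicator_asm)
  qed
qed

text \<open>Weights for the two functions multiply to a common one. After that, additivity is the
  ordinary one, divided by the weight.\<close>

lemma ext_cond_exp_add:
  assumes u: "u \<in> L_cond M F 1" and v: "v \<in> L_cond M F 1"
  shows "AE w in M. \<bar>ext_cond_exp M F v w\<bar> \<noteq> \<infinity> \<and>
    ext_cond_exp M F (\<lambda>w. u w + v w) w = ext_cond_exp M F u w + ext_cond_exp M F v w"
proof -
  obtain h where h: "h \<in> weights" and hu: "integrable M (\<lambda>w. h w * u w)" using u by (auto simp: L_cond_1_iff)
  obtain k where k: "k \<in> weights" and kv: "integrable M (\<lambda>w. k w * v w)" using v by (auto simp: L_cond_1_iff)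
  have [measurable]: "u \<in> borel_measurable M" "v \<in> borel_measurable M" using u v by (auto simp: L_cond_1_iff)
  note [measurable] = weightsD(2)[OF h] weightsD(2)[OF k]
  have hk: "(\<lambda>w. h w * k w) \<in> weights" by (rule weights_mult[OF h k])
  have int_u: "integrable M (\<lambda>w. h w * k w * u w)"
    by (rule Bochner_Integration.integrable_bound[OF hu])
      (use weightsD[OF h] weightsD[OF k] in \<open>auto simp: abs_mult mult.assoc mult_left_le_one_le intro!: AE_I2 mult_left_mono\<close>)
  have int_v: "integrable M (\<lambda>w. h w * k w * v w)"
    by (rule Bochner_Integration.integrable_bound[OF kv])
      (use weightsD[OF h] weightsD[OF k] in \<open>auto simp: abs_mult mult.assoc intro!: AE_I2 mult_left_le_one_le\<close>)
  have int_uv: "integrable M (\<lambda>w. h w * k w * (u w + v w))"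
    using Bochner_Integration.integrable_add[OF int_u int_v] by (simp add: distrib_left)
  have "AE w in M. real_cond_exp M F (\<lambda>w. h w * k w * (u w + v w)) w
      = real_cond_exp M F (\<lambda>w. h w * k w * u w) w + real_cond_exp M F (\<lambda>w. h w * k w * v w) w"
    using real_cond_exp_add[OF int_u int_v] by (simp add: distrib_left)
  moreover have "AE w in M. ext_cond_exp M F u w = ereal (real_cond_exp M F (\<lambda>w. h w * k w * u w) w / (h w * k w))"
    by (rule ext_cond_exp_weighted[OF hk _ int_u]) measurable
  moreover have "AE w in M. ext_cond_exp M F v w = ereal (real_cond_exp M F (\<lambda>w. h w * k w * v w) w / (h w * k w))"
    by (rule ext_cond_exp_weighted[OF hk _ int_v]) measurable
  moreover have "AE w in M. ext_cond_exp M F (\<lambda>w. u w + v w) w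
      = ereal (real_cond_exp M F (\<lambda>w. h w * k w * (u w + v w)) w / (h w * k w))"
    by (rule ext_cond_exp_weighted[OF hk _ int_uv]) measurable
  ultimately show ?thesis by eventually_elim (simp add: add_divide_distrib)
qed

end

section \<open>The Koethe dual inside L^q for conjugate exponents\<close>

context cond_Lp begin

text \<open>Translates the extended relation between p and q to real exponents: q = \<infinity>
  forces r = 1, and otherwise both exponents exceed 1 because neither reciprocal can be 0.\<close>

lemma kothe_dual_subset:
  assumes pq: "holder_conjugate p q" and y: "y \<in> kothe_dual M F X"
  shows "y \<in> L_cond M F q"
proof -
  have pq': "1 \<le> q" "1 / p + 1 / q = 1" using pq unfolding holder_conjugate_def by blast+
  define a where "a = r"
  have p_eq: "p = ennreal a" and a1: "1 \<le> a" using p_finite r_ge_1 by (simp_all add: a_def)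
  show ?thesis
  proof (cases "q = \<infinity>")
    case True
    then have "ennreal (1 / a) = ennreal 1"
      using pq'(2) a1 by (simp add: p_eq divide_ennreal flip: ennreal_1)
    then have "1 / a = 1" using a1 by (subst (asm) ennreal_inj) auto
    then have "r = 1" using a1 by (simp add: a_def)
    then show ?thesis using kothe_dual_subset_infinity[OF _ y] True by simp
  next
    case False
    then have q: "q < \<infinity>" by (cases q) auto
    define s where "s = enn2real q"
    have q_eq: "q = ennreal s" using q by (simp add: s_def)
    have s1: "1 \<le> s" using pq'(1) q by (cases q) (auto simp: s_def)
    have "ennreal (1 / a + 1 / s) = ennreal (1 / a) + ennreal (1 / s)"
      using a1 s1 by (intro ennreal_plus) auto
    also have "\<dots> = ennreal 1 / ennreal a + ennreal 1 / ennreal s"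
      using a1 s1 by (simp only: divide_ennreal)
    also have "\<dots> = ennreal 1" using pq'(2) by (simp only: p_eq q_eq ennreal_1)
    finally have as: "1 / a + 1 / s = 1" using a1 s1 by (subst (asm) ennreal_inj) auto
    have "a \<noteq> 1" "s \<noteq> 1" using as a1 s1 by auto
    then have "1 < a" "1 < s" using a1 s1 by auto
    then show ?thesis using kothe_dual_subset_finite[OF q _ _ _ y] as by (simp add: s_def a_def)
  qed
qed

end

section \<open>From the scalar minorant to conditional subgradients on all of L^p\<close>

context cond_risk begin

text \<open>The minorant inequality is tested with the bounded directions -min(|d|, n). By y \<le> 0
  the left sides are integrals of nonnegative functions increasing to h |d y|, while monotonicity
  bounds all right sides through the single increment in direction -|d|.\<close>

lemma density_minorant_product:
  assumes x: "x \<in> X" and y_meas: "y \<in> borel_measurable M" and y0: "\<And>w. y w \<le> 0" and y_int: "integrable M y"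
    and y: "\<And>d. d \<in> bounded_functions \<Longrightarrow> (\<integral>w. d w * y w \<partial>M) \<le> mean_increment x d" and d: "d \<in> X"
  shows "(\<lambda>w. d w * y w) \<in> L_cond M F 1"
proof -
  note [measurable] = y_meas X_measurable[OF d]
  define a where "a n w = min \<bar>d w\<bar> (real n)" for n w
  have a0: "0 \<le> a n w" and a_le: "a n w \<le> \<bar>d w\<bar>" "a n w \<le> real n" for n w by (auto simp: a_def)
  have [measurable]: "a n \<in> borel_measurable M" for n by (simp add: a_def[abs_def])
  have aB: "(\<lambda>w. - a n w) \<in> bounded_functions" for n
    using a0 a_le by (intro bounded_functionsI[of _ "real n"]) auto
  have dX: "(\<lambda>w. - \<bar>d w\<bar>) \<in> X" using X_cmult[OF X_abs[OF d], of "-1"] by simp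
  \<comment> \<open>Makes h times the increment in direction -|d| at most 1, which is the uniform
    bound needed for monotone convergence.\<close>
  define h where "h w = 1 / (1 + \<bar>increment x (\<lambda>w. - \<bar>d w\<bar>) w\<bar>)" for w
  have h: "h \<in> weights" unfolding h_def by (intro weights_inverse increment_measurable x dX)
  note [measurable] = weightsD(2)[OF h]
  have le1: "(\<integral>\<^sup>+ w. ennreal (h w * a n w * - y w) \<partial>M) \<le> 1" for n
  proof -
    have "(\<integral>w. h w * - a n w * y w \<partial>M) \<le> (\<integral>w. h w * increment x (\<lambda>w. - a n w) w \<partial>M)"
      by (rule density_minorant_local[OF x y weightsD(1,5,4)[OF h] aB])
    also have "\<dots> \<le> (\<integral>w. 1 \<partial>M)"
    proof (rule integral_mono_AE)
      show "integrable M (\<lambda>w. h w * increment x (\<lambda>w. - a n w) w)"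
        by (rule density_minorant_local[OF x y weightsD(1,5,4)[OF h] aB])
      have "AE w in M. increment x (\<lambda>w. - a n w) w \<le> increment x (\<lambda>w. - \<bar>d w\<bar>) w"
        using a_le by (intro increment_mono x dX bounded_functions_X[OF aB]) auto
      then show "AE w in M. h w * increment x (\<lambda>w. - a n w) w \<le> 1"
        by eventually_elim (simp add: h_def divide_le_eq add_pos_nonneg)
    qed simp
    finally have le: "(\<integral>w. h w * a n w * - y w \<partial>M) \<le> 1" by (simp add: prob_space)
    have "integrable M (\<lambda>w. h w * a n w * - y w)"
    proof (rule Bochner_Integration.integrable_bound[of M "\<lambda>w. real n * y w"])
      show "AE w in M. norm (h w * a n w * - y w) \<le> norm (real n * y w)"
      proof (rule AE_I2)
        fix w
        have "h w * a n w \<le> 1 * real n"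
          using weightsD(4,5)[OF h, of w] a0[of n w] a_le(2)[of n w] by (intro mult_mono) auto
        then have "h w * a n w * \<bar>y w\<bar> \<le> real n * \<bar>y w\<bar>" by (intro mult_right_mono) auto
        then show "norm (h w * a n w * - y w) \<le> norm (real n * y w)"
          using weightsD(5)[OF h, of w] a0[of n w] by (simp add: abs_mult)
      qed
    qed (use y_int in auto)
    then have "(\<integral>\<^sup>+ w. ennreal (h w * a n w * - y w) \<partial>M) = ennreal (\<integral>w. h w * a n w * - y w \<partial>M)"
      using weightsD(5)[OF h] a0 y0 by (intro nn_integral_eq_integral AE_I2 mult_nonneg_nonneg) auto
    then show ?thesis using le by (simp add: ennreal_le_1)
  qed
  have SUP_a: "(SUP n. ennreal (h w * a n w * - y w)) = ennreal (h w * \<bar>d w\<bar> * - y w)" for w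
  proof (rule antisym)
    show "(SUP n. ennreal (h w * a n w * - y w)) \<le> ennreal (h w * \<bar>d w\<bar> * - y w)"
      using weightsD(5)[OF h] a_le y0 by (intro SUP_least ennreal_leI mult_right_mono mult_left_mono) auto
    obtain n where "\<bar>d w\<bar> \<le> real n" using real_arch_simple by blast
    then have "a n w = \<bar>d w\<bar>" by (simp add: a_def)
    then show "ennreal (h w * \<bar>d w\<bar> * - y w) \<le> (SUP n. ennreal (h w * a n w * - y w))"
      by (intro SUP_upper2[of n]) auto
  qed
  have "(\<integral>\<^sup>+ w. ennreal (norm (h w * (d w * y w))) \<partial>M) = (\<integral>\<^sup>+ w. (SUP n. ennreal (h w * a n w * - y w)) \<partial>M)"
    unfolding SUP_a using weightsD(5)[OF h] y0 by (intro nn_integral_cong) (simp add: abs_mult mult.assoc)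
  also have "\<dots> = (SUP n. \<integral>\<^sup>+ w. ennreal (h w * a n w * - y w) \<partial>M)"
  proof (rule nn_integral_monotone_convergence_SUP)
    show "incseq (\<lambda>n w. ennreal (h w * a n w * - y w))"
    proof (intro incseq_SucI le_funI ennreal_leI mult_right_mono mult_left_mono)
      show "a n w \<le> a (Suc n) w" for n w by (auto simp: a_def)
    qed (use weightsD(5)[OF h] y0 in auto)
  qed measurable
  also have "\<dots> \<le> 1" by (intro SUP_least le1)
  also have "\<dots> < \<infinity>" by simp
  finally have "integrable M (\<lambda>w. h w * (d w * y w))" by (intro integrableI_bounded) auto
  then show ?thesis using h by (auto simp: L_cond_1_iff)
qed

text \<open>A weight is needed that makes d y integrable and at the same time bounds the increments
  of all truncations of d. Dominated convergence then carries the localized inequality from the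
  truncations to d, and comparison over F-sets gives the conditional form.\<close>

lemma density_minorant_increment:
  assumes x: "x \<in> X" and y_meas: "y \<in> borel_measurable M"
    and y: "\<And>d. d \<in> bounded_functions \<Longrightarrow> (\<integral>w. d w * y w \<partial>M) \<le> mean_increment x d" and d: "d \<in> X"
    and prod: "(\<lambda>w. d w * y w) \<in> L_cond M F 1"
  shows "AE w in M. ext_cond_exp M F (\<lambda>w. d w * y w) w \<le> ereal (increment x d w)"
proof -
  note [measurable] = y_meas X_measurable[OF d]
  obtain h where h: "h \<in> weights" and hdy: "integrable M (\<lambda>w. h w * (d w * y w))"
    using prod by (auto simp: L_cond_1_iff)
  have aX: "(\<lambda>w. \<bar>d w\<bar>) \<in> X" by (rule X_abs[OF d])
  have maX: "(\<lambda>w. - \<bar>d w\<bar>) \<in> X" using X_cmult[OF aX, of "-1"] by simp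
  \<comment> \<open>Every e with |e| \<le> |d| has its increment between those in the directions |d|
    and -|d|, so this one weight bounds all of them by 1.\<close>
  define k where "k w = 1 / (1 + \<bar>\<bar>increment x (\<lambda>w. \<bar>d w\<bar>) w\<bar> + \<bar>increment x (\<lambda>w. - \<bar>d w\<bar>) w\<bar>\<bar>)" for w
  have k: "k \<in> weights" unfolding k_def
    by (intro weights_inverse borel_measurable_add borel_measurable_abs increment_measurable x aX maX)
  define H where "H w = h w * k w" for w
  have H: "H \<in> weights" unfolding H_def by (rule weights_mult[OF h k])
  note [measurable] = weightsD(2)[OF h] weightsD(2)[OF k] weightsD(1,2)[OF H]
  have H_le: "H w \<le> k w" "H w \<le> h w" for w
    using weightsD[OF h] weightsD[OF k] by (auto simp: H_def mult_left_le mult_left_le_one_le less_imp_le)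
  have H_int: "integrable M (\<lambda>w. H w * (d w * y w))"
    by (rule Bochner_Integration.integrable_bound[OF hdy])
      (use H_le weightsD(5)[OF H] weightsD(5)[OF h] in \<open>auto simp: abs_mult intro!: AE_I2 mult_right_mono\<close>)
  have between: "AE w in M. \<bar>H w * increment x e w\<bar> \<le> 1" if e: "e \<in> X" "\<And>w. \<bar>e w\<bar> \<le> \<bar>d w\<bar>" for e
  proof -
    have "AE w in M. increment x (\<lambda>w. \<bar>d w\<bar>) w \<le> increment x e w"
      using e(2) by (intro increment_mono x e aX AE_I2) (metis abs_le_iff)
    moreover have "AE w in M. increment x e w \<le> increment x (\<lambda>w. - \<bar>d w\<bar>) w"
      using e(2) by (intro increment_mono x e maX AE_I2) (metis abs_le_iff minus_le_iff)
    ultimately show ?thesis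
    proof eventually_elim
      case (elim w)
      define m where "m = \<bar>increment x (\<lambda>w. \<bar>d w\<bar>) w\<bar> + \<bar>increment x (\<lambda>w. - \<bar>d w\<bar>) w\<bar>"
      have "\<bar>increment x e w\<bar> \<le> m" using elim by (auto simp: m_def)
      then have "H w * \<bar>increment x e w\<bar> \<le> k w * m"
        using H_le(1)[of w] weightsD(5)[OF H, of w] weightsD(5)[OF k, of w] by (intro mult_mono) auto
      also have "k w * m = m / (1 + m)" by (simp add: k_def m_def)
      also have "\<dots> \<le> 1" by (simp add: m_def divide_le_eq add_pos_nonneg)
      finally show ?case using weightsD(5)[OF H, of w] by (simp add: abs_mult)
    qed
  qed
  have inc_meas[measurable]: "increment x e \<in> borel_measurable F" if "e \<in> X" for e
    by (rule increment_measurable[OF x that])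
  have inc_meas'[measurable]: "increment x e \<in> borel_measurable M" if "e \<in> X" for e
    by (rule F_measurable[OF inc_meas[OF that]])
  have int_d: "integrable M (\<lambda>w. H w * increment x d w)"
    by (rule integrable_const_bound[of _ 1]) (use between[OF d] inc_meas'[OF d] in auto)
  have "AE w in M. real_cond_exp M F (\<lambda>w. H w * (d w * y w)) w \<le> H w * increment x d w"
  proof (rule real_cond_exp_leI[OF H_int int_d])
    show "(\<lambda>w. H w * increment x d w) \<in> borel_measurable F" using inc_meas[OF d] by measurable
    fix A assume A[measurable]: "A \<in> sets F"
    have [measurable]: "A \<in> sets M" by (rule F_sets[OF A])
    define e where "e n w = max (- real n) (min (d w) (real n))" for n w
    have [measurable]: "e n \<in> borel_measurable M" for n by (simp add: e_def[abs_def])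
    have eB: "e n \<in> bounded_functions" for n
      by (rule bounded_functionsI[of _ "real n"]) (auto simp: e_def)
    have eX: "e n \<in> X" for n by (rule bounded_functions_X[OF eB])
    have e_le: "\<bar>e n w\<bar> \<le> \<bar>d w\<bar>" for n w by (auto simp: e_def)
    have e_lim: "(\<lambda>n. e n w) \<longlonglongrightarrow> d w" for w
    proof (rule tendsto_eventually)
      obtain m where "\<bar>d w\<bar> \<le> real m" using real_arch_simple by blast
      then show "\<forall>\<^sub>F n in sequentially. e n w = d w"
        by (auto simp: eventually_sequentially e_def intro!: exI[of _ m])
    qed
    \<comment> \<open>One multiplier carries both the test set \<open>A\<close> and the weight
      \<open>H\<close>. It is F-measurable with values in [0,1], as localization requires.\<close>
    define \<eta> where "\<eta> w = indicator A w * H w" for w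
    have \<eta>: "\<eta> \<in> borel_measurable F" "\<And>w. 0 \<le> \<eta> w" "\<And>w. \<eta> w \<le> 1"
      using weightsD(4,5)[OF H] by (auto simp: \<eta>_def[abs_def] split: split_indicator)
    have \<eta>_le: "\<eta> w \<le> H w" for w using weightsD(5)[OF H] by (auto simp: \<eta>_def split: split_indicator)
    note [measurable] = \<eta>(1) F_measurable[OF \<eta>(1)]
    have step: "(\<integral>w. \<eta> w * e n w * y w \<partial>M) \<le> (\<integral>w. \<eta> w * increment x (e n) w \<partial>M)" for n
      by (rule density_minorant_local[OF x y \<eta> eB])
    have lim1: "(\<lambda>n. \<integral>w. \<eta> w * e n w * y w \<partial>M) \<longlonglongrightarrow> (\<integral>w. \<eta> w * d w * y w \<partial>M)"
    proof (rule integral_dominated_convergence[where w = "\<lambda>w. norm (H w * (d w * y w))"])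
      show "AE w in M. (\<lambda>n. \<eta> w * e n w * y w) \<longlonglongrightarrow> \<eta> w * d w * y w"
        by (intro AE_I2 tendsto_intros e_lim)
      show "AE w in M. norm (\<eta> w * e n w * y w) \<le> norm (H w * (d w * y w))" for n
      proof (rule AE_I2)
        fix w
        have "\<eta> w * (\<bar>e n w\<bar> * \<bar>y w\<bar>) \<le> H w * (\<bar>d w\<bar> * \<bar>y w\<bar>)"
          using \<eta>_le[of w] e_le[of n w] weightsD(5)[OF H, of w] by (intro mult_mono mult_right_mono) auto
        then show "norm (\<eta> w * e n w * y w) \<le> norm (H w * (d w * y w))"
          using \<eta>(2)[of w] weightsD(5)[OF H, of w] by (simp add: abs_mult mult.assoc)
      qed
    qed (use H_int in auto)
    have lim2: "(\<lambda>n. \<integral>w. \<eta> w * increment x (e n) w \<partial>M) \<longlonglongrightarrow> (\<integral>w. \<eta> w * increment x d w \<partial>M)"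
    proof (rule integral_dominated_convergence[where w = "\<lambda>w. 1"])
      have "AE w in M. (\<lambda>n. increment x (e n) w) \<longlonglongrightarrow> increment x d w"
        by (rule increment_tendsto[OF x eX d aX]) (use e_le e_lim in auto)
      then show "AE w in M. (\<lambda>n. \<eta> w * increment x (e n) w) \<longlonglongrightarrow> \<eta> w * increment x d w"
        by eventually_elim (intro tendsto_intros)
      show "AE w in M. norm (\<eta> w * increment x (e n) w) \<le> 1" for n
        using between[OF eX e_le]
        by eventually_elim (auto simp: \<eta>_def split: split_indicator)
    qed (use inc_meas'[OF eX] inc_meas'[OF d] in auto)
    have "(\<integral>w. \<eta> w * d w * y w \<partial>M) \<le> (\<integral>w. \<eta> w * increment x d w \<partial>M)"
      by (rule LIMSEQ_le[OF lim1 lim2]) (use step in auto)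
    then show "(\<integral>w. indicator A w * (H w * (d w * y w)) \<partial>M) \<le> (\<integral>w. indicator A w * (H w * increment x d w) \<partial>M)"
      by (simp add: \<eta>_def mult.assoc)
  qed
  moreover have "AE w in M. ext_cond_exp M F (\<lambda>w. d w * y w) w = ereal (real_cond_exp M F (\<lambda>w. H w * (d w * y w)) w / H w)"
    by (rule ext_cond_exp_weighted[OF H _ H_int]) measurable
  ultimately show ?thesis
  proof eventually_elim
    case (elim w)
    then show ?case using weightsD(3)[OF H, of w] by (simp add: divide_le_eq mult.commute)
  qed
qed

text \<open>The density of the averaged problem is itself the conditional subgradient at
  \<open>x\<close>. Cash invariance fixes its conditional mean, since increments in constant
  directions are known exactly.\<close>

theorem subgradient_exists:
  assumes x: "x \<in> X"
  obtains y where "y \<in> kothe_dual M F X" "\<And>w. y w \<le> 0" "AE w in M. ext_cond_exp M F y w = - 1"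
    "\<And>d. d \<in> X \<Longrightarrow> AE w in M. ext_cond_exp M F (\<lambda>w. d w * y w) w \<le> ereal (increment x d w)"
proof -
  obtain y where y: "y \<in> borel_measurable M" "\<And>w. y w \<le> 0" "integrable M y"
    "\<And>d. d \<in> bounded_functions \<Longrightarrow> (\<integral>w. d w * y w \<partial>M) \<le> mean_increment x d"
    using density_minorant[OF x] by blast
  have prod: "(\<lambda>w. d w * y w) \<in> L_cond M F 1" if "d \<in> X" for d
    by (rule density_minorant_product[OF x y(1-3) _ that]) (rule y(4))
  have le: "AE w in M. ext_cond_exp M F (\<lambda>w. d w * y w) w \<le> ereal (increment x d w)" if "d \<in> X" for d
    by (rule density_minorant_increment[OF x y(1) _ that prod[OF that]]) (rule y(4))
  have ext: "AE w in M. ext_cond_exp M F (\<lambda>w. c * y w) w = ereal (c * real_cond_exp M F y w)" for c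
  proof -
    have int: "integrable M (\<lambda>w. 1 * (c * y w))" using y(3) by simp
    have "AE w in M. ext_cond_exp M F (\<lambda>w. c * y w) w = ereal (real_cond_exp M F (\<lambda>w. 1 * (c * y w)) w / 1)"
      by (rule ext_cond_exp_weighted[OF weights_one _ int]) (use y(1) in measurable)
    with real_cond_exp_cmult[OF y(3), of c] show ?thesis by eventually_elim simp
  qed
  \<comment> \<open>The case c = 1 gives E[y|F] \<le> -1 and c = -1 gives the opposite
    inequality.\<close>
  have "AE w in M. c * real_cond_exp M F y w \<le> - c" for c
    using le[OF X_const[of c]] ext[of c] increment_F_measurable[OF x borel_measurable_const, of c]
    by eventually_elim auto
  from this[of 1] this[of "-1"] ext[of 1] have "AE w in M. ext_cond_exp M F (\<lambda>w. 1 * y w) w = - 1"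
    by eventually_elim (auto simp: one_ereal_def)
  then have "AE w in M. ext_cond_exp M F y w = - 1" by simp
  moreover have "y \<in> kothe_dual M F X"
    using y(1) prod by (simp add: kothe_dual_def)
  ultimately show thesis using y(2) le by (intro that[of y]) auto
qed

text \<open>For z in \<open>X\<close>, the subgradient inequality in direction z - x says E[zy|F] -
  \<rho>(z) \<le> E[xy|F] - \<rho>(x). The right side is therefore the essential supremum, and it is
  finite, so it can be solved for \<rho>(x).\<close>

lemma fenchel_transform_attained:
  assumes x: "x \<in> X" and y: "y \<in> kothe_dual M F X"
    and sub: "\<And>d. d \<in> X \<Longrightarrow> AE w in M. ext_cond_exp M F (\<lambda>w. d w * y w) w \<le> ereal (increment x d w)"
  shows "AE w in M. ereal (\<rho> x w) = ext_cond_exp M F (\<lambda>w. x w * y w) w - fenchel_transform M F X \<rho> y w"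
proof -
  have L1: "(\<lambda>w. d w * y w) \<in> L_cond M F 1" if "d \<in> X" for d
    using y that by (simp add: kothe_dual_def)
  obtain h where h: "h \<in> weights" and int: "integrable M (\<lambda>w. h w * (x w * y w))"
    using L1[OF x] by (auto simp: L_cond_1_iff)
  have xy_meas: "(\<lambda>w. x w * y w) \<in> borel_measurable M" using L1[OF x] by (simp add: L_cond_1_iff)
  note [measurable] = weightsD(1)[OF h] rho_measurable[OF x]
  \<comment> \<open>An F-measurable, real-valued representative of E[xy|F]. It makes the candidate
    supremum \<open>s\<close> F-measurable and excludes \<infinity> - \<infinity> in the
    rearrangements below.\<close>
  define g where "g w = real_cond_exp M F (\<lambda>w. h w * (x w * y w)) w / h w" for w
  have g: "AE w in M. ext_cond_exp M F (\<lambda>w. x w * y w) w = ereal (g w)"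
    unfolding g_def by (rule ext_cond_exp_weighted[OF h xy_meas int])
  have g_meas[measurable]: "g \<in> borel_measurable F" by (simp add: g_def[abs_def])
  define s where "s w = ereal (g w - \<rho> x w)" for w
  define S where "S = (\<lambda>x \<omega>. ext_cond_exp M F (\<lambda>w. x w * y w) \<omega> - ereal (\<rho> x \<omega>)) ` X"
  have upper: "AE w in M. ext_cond_exp M F (\<lambda>w. z w * y w) w - ereal (\<rho> z w) \<le> s w" if z: "z \<in> X" for z
  proof -
    have d: "(\<lambda>w. z w - x w) \<in> X" by (rule X_diff[OF z x])
    have "AE w in M. ext_cond_exp M F (\<lambda>w. (z w - x w) * y w + x w * y w) w
        = ext_cond_exp M F (\<lambda>w. (z w - x w) * y w) w + ext_cond_exp M F (\<lambda>w. x w * y w) w"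
      using ext_cond_exp_add[OF L1[OF d] L1[OF x]] by eventually_elim simp
    then have "AE w in M. ext_cond_exp M F (\<lambda>w. z w * y w) w
        = ext_cond_exp M F (\<lambda>w. (z w - x w) * y w) w + ext_cond_exp M F (\<lambda>w. x w * y w) w"
      by (simp add: left_diff_distrib)
    with g sub[OF d] show ?thesis
    proof eventually_elim
      case (elim w)
      have "ext_cond_exp M F (\<lambda>w. (z w - x w) * y w) w + ereal (g w) \<le> ereal (\<rho> z w - \<rho> x w) + ereal (g w)"
        by (rule add_right_mono) (use elim in \<open>simp add: increment_def\<close>)
      then have "ext_cond_exp M F (\<lambda>w. z w * y w) w \<le> ereal (\<rho> z w - \<rho> x w) + ereal (g w)"
        using elim by simp
      then have "ext_cond_exp M F (\<lambda>w. z w * y w) w - ereal (\<rho> z w) \<le> ereal (\<rho> z w - \<rho> x w) + ereal (g w) - ereal (\<rho> z w)"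
        by (rule ereal_minus_mono) simp
      then show ?case by (simp add: s_def)
    qed
  qed
  have attained: "AE w in M. ext_cond_exp M F (\<lambda>w. x w * y w) w - ereal (\<rho> x w) = s w"
    using g by eventually_elim (simp add: s_def)
  have "is_ess_sup M F S s"
    unfolding is_ess_sup_def
  proof (intro conjI ballI impI)
    show "s \<in> borel_measurable F" unfolding s_def[abs_def] by measurable
    show "AE w in M. f w \<le> s w" if "f \<in> S" for f using that upper by (auto simp: S_def)
    fix t assume "\<forall>f\<in>S. AE w in M. f w \<le> t w"
    then have "AE w in M. ext_cond_exp M F (\<lambda>w. x w * y w) w - ereal (\<rho> x w) \<le> t w" using x by (auto simp: S_def)
    with attained show "AE w in M. s w \<le> t w" by eventually_elim simp
  qed
  \<comment> \<open>\<open>s\<close> witnesses that an essential supremum exists, so the chosen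
    \<open>ess_sup\<close> is one too. Two essential suprema bound each other and agree almost
    everywhere.\<close>
  then have is_sup: "is_ess_sup M F S (ess_sup M F S)" unfolding ess_sup_def by (rule someI[of "is_ess_sup M F S"])
  have "AE w in M. ess_sup M F S w \<le> s w"
    using is_sup \<open>is_ess_sup M F S s\<close> unfolding is_ess_sup_def by blast
  moreover have "AE w in M. s w \<le> ess_sup M F S w"
    using is_sup \<open>is_ess_sup M F S s\<close> unfolding is_ess_sup_def by blast
  ultimately have "AE w in M. ereal (\<rho> x w) = ext_cond_exp M F (\<lambda>w. x w * y w) w - ess_sup M F S w"
    using g
  proof eventually_elim
    case (elim w)
    then have "ess_sup M F S w = ereal (g w - \<rho> x w)" by (simp add: s_def)
    then show ?case using elim by simp
  qed
  then show ?thesis using y by (simp add: fenchel_transform_def S_def)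
qed

end

theorem theorem3p5:
  fixes M F :: "'a measure" and p q :: ennreal
    and \<rho> :: "('a \<Rightarrow> real) \<Rightarrow> 'a \<Rightarrow> real"
  assumes "prob_space M" and "subalgebra M F"
    and "holder_conjugate p q" and "p < \<infinity>"
    and "cond_risk_measure M F (L_cond M F p) \<rho>"
  shows "lebesgue_property M (L_cond M F p) \<rho> \<and>
    (\<forall>x \<in> L_cond M F p. \<exists>y \<in> L_cond M F q.
       (AE \<omega> in M. y \<omega> \<le> 0) \<and>
       (AE \<omega> in M. ext_cond_exp M F y \<omega> = -1) \<and>
       (AE \<omega> in M. ereal (\<rho> x \<omega>) =
          ext_cond_exp M F (\<lambda>w. x w * y w) \<omega> - fenchel_transform M F (L_cond M F p) \<rho> y \<omega>))"
proof -
  interpret prob_space M by fact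
  interpret cond_risk M F p \<rho>
    using assms by unfold_locales (auto simp: holder_conjugate_def)
  show ?thesis
  proof (intro conjI ballI lebesgue_property_rho)
    fix x assume x: "x \<in> X"
    obtain y where y: "y \<in> kothe_dual M F X" "\<And>w. y w \<le> 0" "AE w in M. ext_cond_exp M F y w = - 1"
      "\<And>d. d \<in> X \<Longrightarrow> AE w in M. ext_cond_exp M F (\<lambda>w. d w * y w) w \<le> ereal (increment x d w)"
      using subgradient_exists[OF x] by blast
    show "\<exists>y \<in> L_cond M F q. (AE \<omega> in M. y \<omega> \<le> 0) \<and> (AE \<omega> in M. ext_cond_exp M F y \<omega> = -1) \<and>
       (AE \<omega> in M. ereal (\<rho> x \<omega>) = ext_cond_exp M F (\<lambda>w. x w * y w) \<omega> - fenchel_transform M F X \<rho> y \<omega>)"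
      using kothe_dual_subset[OF assms(3) y(1)] y(2,3) fenchel_transform_attained[OF x y(1,4)] by auto
  qed
qed

end
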